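(* Let $G$ and $G'$ each be both a groupoid and a topological space (no compatibility assumed) with Hausdorff unit space, and let $Y$ and $Y'$ be indecomposable semigroupoids. Let $A\subseteq{}_Y\mathcal{O}(G)$ and $A'\subseteq{}_{Y'}\mathcal{O}(G')$ be semigroups whose products $ab$ are given by $ab(gh)=a(g)b(h)$ (whenever this is defined) whenever $\mathrm{dom}(a)$ or $\mathrm{dom}(b)$ is a bisection. Let $Z,D,S,C,N\subseteq A$ and $Z',D',S',C',N'\subseteq A'$ be the subsets defined in the context. If (1) $\mathrm{dom}(ab)\subseteq\mathrm{dom}(a)\mathrm{dom}(b)$ whenever $a,b\in N$ or $a,b\in N'$, (2) $D$ and $D'$ are exhaustive, (3) $S$ and $S'$ are compact-bumpy, (4) $G$ and $G'$ are ample, (5) $C^{\mathsf{R}}_Z\subseteq S$ and $C'^{\mathsf{R}}_{Z'}\subseteq S'$, and (6) $A$ and $A'$ are diagonally isomorphic, then $G$ and $G'$ are isomorphic étale groupoids (i.e. there is a groupoid isomorphism $G\to G'$ that is a homeomorphism).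
   Context: For a groupoid $G$: $\mathsf{s}(g)=g^{-1}g$, $\mathsf{r}(g)=gg^{-1}$; $G^0$ is the set of units; $gh$ is defined iff $\mathsf{s}(g)=\mathsf{r}(h)$; for $X,X'\subseteq G$, $XX'=\{xx':x\in X,x'\in X',\mathsf{s}(x)=\mathsf{r}(x')\}$ and $X^{-1}=\{x^{-1}:x\in X\}$. $\mathcal{O}(G)$ is the topology; $\mathrm{int}$ denotes interior in $G$. A bisection is $B\subseteq G$ with $BB^{-1}\cup B^{-1}B\subseteq G^0$; $\mathcal{B}^\circ(G)$, $\mathcal{B}_\mathsf{c}(G)$, $\mathcal{B}^\circ_\mathsf{c}(G)$ are the sets of open, compact, and compact open bisections. $G^{\mathrm{iso}}=\{g\in G:\mathsf{s}(g)=\mathsf{r}(g)\}$; an isosection is $I\subseteq G$ with $II^{-1}\cup I^{-1}I\subseteq G^{\mathrm{iso}}$. $G$ is étale if inversion and multiplication are continuous and $\mathsf{s}$ is a local homeomorphism onto an open subset of $G$. $G$ is ample if some $\mathcal{B}\subseteq\mathcal{B}^\circ_\mathsf{c}(G)$ is a basis for the topology closed under $(O,N)\mapsto ON$ and $O\mapsto O^{-1}$ (ample groupoids are étale). A semigroupoid $Y$ is a set with a partial product that is associative: $x(yz)$ is defined iff $(xy)z$ is, in which case they are equal. A unit $1\in Y$ is an element with $1y$ and $y1$ defined and equal to $y$ for all $y$. $Y^\times$ is the set of $y$ having $y^{-1}\in Y$ with $yy^{-1}=1=y^{-1}y$. The centre $\mathsf{Z}(Y)$ is the set of $z\in Y$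 such that, for all $y$, $yz$ is defined iff $zy$ is, in which case they are equal. $Y$ is indecomposable if it has a unit and $1$ is the only idempotent in $\mathsf{Z}(Y)$. For a family $\mathcal{X}$ of subsets of $G$, ${}_Y\mathcal{X}$ is the set of partial functions $a$ from $G$ to $Y$ with domain $\mathrm{dom}(a)\in\mathcal{X}$; $\mathrm{ran}(a)$ is the range; for $W\subseteq Y$, $[W]a=\{g\in\mathrm{dom}(a):a(g)\in W\}$, $[1]a=[\{1\}]a$. The assumption on $A$: it is a set of partial functions with open domains carrying an (everywhere defined) associative product such that, whenever $\mathrm{dom}(a)$ or $\mathrm{dom}(b)$ is a bisection, $ab$ is the function given by $ab(gh)=a(g)b(h)$, with domain consisting of those $gh$ with $g\in\mathrm{dom}(a)$, $h\in\mathrm{dom}(b)$, $\mathsf{s}(g)=\mathsf{r}(h)$ and $a(g)b(h)$ defined in $Y$. (Nothing but associativity is assumed about other products.) Likewise for $A'$. Subsets of $A$ (and analogously primed subsets of $A'$): $Z=\{a\in A:\mathrm{dom}(a)\subseteq G^0,\ \mathrm{ran}(a)\subseteq\mathsf{Z}(Y)\}$; $D=\{a\in A:\mathrm{dom}(a)\subseteq G^0\}$; $S=\{a\in A:\mathrm{dom}(a)\text{ is a bisection}\}$; $C=\{a\in A:\mathrm{dom}(a)\subseteq G^{\mathrm{iso}}\}$; $N=\{a\in A:\mathrm{dom}(a)\text{ is an isosection}\}$; $C^{\mathsf{R}}_Z=\{c\in C:\exists c'\in C\ (cc',c'c\in Z,\ cc'c=c,\ c'cc'=c')\}$. $D$ is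 exhaustive if for all $g\in G^0$ and $y\in Y$ there is $d\in D$ with $d(g)=y$. $A$ and $A'$ are diagonally isomorphic if there is a semigroup isomorphism $\phi:A\to A'$ with $\phi[D]=D'$. $S\subseteq{}_Y\mathcal{B}^\circ(G)$ is compact-bumpy if: (1-Proper) $[1]a$ is compact for all $a\in S$; (Urysohn) the empty function is in $S$, and whenever $g\in O\in\mathcal{O}(G)$ there is $a\in S$ with $\mathrm{dom}(a)\subseteq O$ and $g\in\mathrm{int}([Y^\times]a)$; (Involutive) whenever $a\in S$ and $g\in\mathrm{int}([Y^\times]a)$, there is $b\in S$ with $g^{-1}\in\mathrm{int}(\{h\in G:a(h^{-1})=b(h)^{-1}\})$; (Compact-Urysohn) for any $K\in\mathcal{B}_\mathsf{c}(G)$ and $O\in\mathcal{B}^\circ(G)$ with $K\subseteq O$ there is $a\in S$ with $\mathrm{dom}(a)\subseteq O$ and $K\subseteq[Y^\times]a$; (Compact-Involutive) if $a\in S$ and $K\subseteq[Y^\times]a$ is compact, there is $b\in S$ with $a(g)^{-1}=b(g^{-1})$ for all $g\in K$. *)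

theory Defs
  imports "HOL-Analysis.Analysis"
begin

section \<open>Semigroupoids\<close>

text \<open>The product is partial: \<^term>\<open>None\<close> stands for ``undefined''. Only its values on
  \<open>elems\<close> are relevant.\<close>

record 'a semigroupoid =
  elems :: "'a set"
  mul :: "'a \<Rightarrow> 'a \<Rightarrow> 'a option"

text \<open>Equality of the two options below says that \<open>x(yz)\<close> is defined iff \<open>(xy)z\<close> is, in which case
  they are equal.\<close>

definition semigroupoid :: "('a, 'b) semigroupoid_scheme \<Rightarrow> bool" where
  "semigroupoid Y \<longleftrightarrow>
     (\<forall>x\<in>elems Y. \<forall>y\<in>elems Y. \<forall>z. mul Y x y = Some z \<longrightarrow> z \<in> elems Y) \<and>
     (\<forall>x\<in>elems Y. \<forall>y\<in>elems Y. \<forall>z\<in>elems Y.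
        Option.bind (mul Y y z) (\<lambda>u. mul Y x u) = Option.bind (mul Y x y) (\<lambda>v. mul Y v z))"

definition unit_elem :: "('a, 'b) semigroupoid_scheme \<Rightarrow> 'a \<Rightarrow> bool" where
  "unit_elem Y e \<longleftrightarrow> e \<in> elems Y \<and> (\<forall>y\<in>elems Y. mul Y e y = Some y \<and> mul Y y e = Some y)"

definition one_of :: "('a, 'b) semigroupoid_scheme \<Rightarrow> 'a" where
  "one_of Y = (THE e. unit_elem Y e)"

lemma one_of_eq: "unit_elem Y e \<Longrightarrow> one_of Y = e"
  unfolding one_of_def by (rule the_equality) (auto simp: unit_elem_def)

text \<open>\<open>inverse_of Y y x\<close> says \<open>x = y\<^sup>-\<^sup>1\<close>; inverses are unique by associativity.\<close>

definition inverse_of :: "('a, 'b) semigroupoid_scheme \<Rightarrow> 'a \<Rightarrow> 'a \<Rightarrow> bool" where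
  "inverse_of Y y x \<longleftrightarrow> y \<in> elems Y \<and> x \<in> elems Y \<and>
     mul Y y x = Some (one_of Y) \<and> mul Y x y = Some (one_of Y)"

definition invertibles :: "('a, 'b) semigroupoid_scheme \<Rightarrow> 'a set" where
  "invertibles Y = {y. \<exists>x. inverse_of Y y x}"

definition centre_of :: "('a, 'b) semigroupoid_scheme \<Rightarrow> 'a set" where
  "centre_of Y = {z \<in> elems Y. \<forall>y\<in>elems Y. mul Y y z = mul Y z y}"

definition indecomposable :: "('a, 'b) semigroupoid_scheme \<Rightarrow> bool" where
  "indecomposable Y \<longleftrightarrow> semigroupoid Y \<and> (\<exists>e. unit_elem Y e) \<and>
     {z \<in> centre_of Y. mul Y z z = Some z} = {one_of Y}"


section \<open>Groupoids carrying a topology\<close>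

record 'g top_groupoid = "'g semigroupoid" +
  ginv :: "'g \<Rightarrow> 'g"
  gtop :: "'g topology"

text \<open>The usual axioms for a groupoid with partial product and everywhere defined inversion
  (Hahn, Renault). That \<open>gh\<close> is defined iff \<open>s(g) = r(h)\<close> is a consequence, see
  \<open>groupoid_mul_defined_iff\<close>. The topology is on the same set and otherwise arbitrary.\<close>

definition topologised_groupoid :: "'g top_groupoid \<Rightarrow> bool" where
  "topologised_groupoid G \<longleftrightarrow>
     topspace (gtop G) = elems G \<and>
     (\<forall>g\<in>elems G. ginv G g \<in> elems G \<and> ginv G (ginv G g) = g \<and> mul G (ginv G g) g \<noteq> None) \<and>
     (\<forall>g\<in>elems G. \<forall>h\<in>elems G. \<forall>k. mul G g h = Some k \<longrightarrow>
        k \<in> elems G \<and> mul G (ginv G g) k = Some h \<and> mul G k (ginv G h) = Some g) \<and>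
     (\<forall>g\<in>elems G. \<forall>h\<in>elems G. \<forall>k\<in>elems G. \<forall>gh hk. mul G g h = Some gh \<longrightarrow> mul G h k = Some hk \<longrightarrow>
        (\<exists>ghk. mul G gh k = Some ghk \<and> mul G g hk = Some ghk))"

definition src :: "'g top_groupoid \<Rightarrow> 'g \<Rightarrow> 'g" where
  "src G g = the (mul G (ginv G g) g)"

definition rng :: "'g top_groupoid \<Rightarrow> 'g \<Rightarrow> 'g" where
  "rng G g = the (mul G g (ginv G g))"

lemma groupoid_mul_defined_iff:
  assumes G: "topologised_groupoid G" and g: "g \<in> elems G" and h: "h \<in> elems G"
  shows "mul G g h \<noteq> None \<longleftrightarrow> src G g = rng G h"
proof -
  have inv: "ginv G x \<in> elems G \<and> ginv G (ginv G x) = x \<and> (\<exists>u. mul G (ginv G x) x = Some u)"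
    if "x \<in> elems G" for x
    using G that unfolding topologised_groupoid_def by blast
  have can: "k \<in> elems G \<and> mul G (ginv G x) k = Some y \<and> mul G k (ginv G y) = Some x"
    if "x \<in> elems G" "y \<in> elems G" "mul G x y = Some k" for x y k
    using G that unfolding topologised_groupoid_def by blast
  have assoc: "\<exists>w. mul G xy z = Some w \<and> mul G x yz = Some w"
    if "x \<in> elems G" "y \<in> elems G" "z \<in> elems G" "mul G x y = Some xy" "mul G y z = Some yz"
    for x y z xy yz
    using G that unfolding topologised_groupoid_def by blast
  obtain u where u: "mul G (ginv G g) g = Some u" using inv[OF g] by blast
  obtain v where v: "mul G h (ginv G h) = Some v" using inv[of "ginv G h"] inv[OF h] by auto
  have su: "src G g = u" and rv: "rng G h = v" using u v by (simp_all add: src_def rng_def)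
  have u': "u \<in> elems G" "mul G g u = Some g" using can[OF _ g u] inv[OF g] by auto
  have v': "v \<in> elems G" "mul G v h = Some h" using can[OF h _ v] inv[OF h] by auto
  show ?thesis
  proof
    assume "mul G g h \<noteq> None"
    then obtain k where k: "mul G g h = Some k" by blast
    have k': "k \<in> elems G" "mul G (ginv G g) k = Some h" "mul G k (ginv G h) = Some g"
      using can[OF g h k] by auto
    have "\<exists>w. mul G h (ginv G h) = Some w \<and> mul G (ginv G g) g = Some w"
      using assoc[of "ginv G g" k "ginv G h" h g] k' inv[OF g] inv[OF h] by blast
    then show "src G g = rng G h" using u v su rv by auto
  next
    assume "src G g = rng G h"
    then have "u = v" using su rv by simp
    then show "mul G g h \<noteq> None"
      using assoc[OF g u'(1) h u'(2)] v'(2) by auto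
  qed
qed

definition gunits :: "'g top_groupoid \<Rightarrow> 'g set" where
  "gunits G = src G ` elems G"

definition isotropy :: "'g top_groupoid \<Rightarrow> 'g set" where
  "isotropy G = {g \<in> elems G. src G g = rng G g}"

definition set_mul :: "'g top_groupoid \<Rightarrow> 'g set \<Rightarrow> 'g set \<Rightarrow> 'g set" where
  "set_mul G X X' = {k. \<exists>x\<in>X. \<exists>x'\<in>X'. mul G x x' = Some k}"

definition set_inv :: "'g top_groupoid \<Rightarrow> 'g set \<Rightarrow> 'g set" where
  "set_inv G X = ginv G ` X"

definition bisection :: "'g top_groupoid \<Rightarrow> 'g set \<Rightarrow> bool" where
  "bisection G B \<longleftrightarrow> B \<subseteq> elems G \<and>
     set_mul G B (set_inv G B) \<union> set_mul G (set_inv G B) B \<subseteq> gunits G"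

definition isosection :: "'g top_groupoid \<Rightarrow> 'g set \<Rightarrow> bool" where
  "isosection G I \<longleftrightarrow> I \<subseteq> elems G \<and>
     set_mul G I (set_inv G I) \<union> set_mul G (set_inv G I) I \<subseteq> isotropy G"

definition open_bisections :: "'g top_groupoid \<Rightarrow> 'g set set" where
  "open_bisections G = {B. bisection G B \<and> openin (gtop G) B}"

definition compact_bisections :: "'g top_groupoid \<Rightarrow> 'g set set" where
  "compact_bisections G = {B. bisection G B \<and> compactin (gtop G) B}"

definition ample :: "'g top_groupoid \<Rightarrow> bool" where
  "ample G \<longleftrightarrow> (\<exists>\<B>. \<B> \<subseteq> open_bisections G \<inter> compact_bisections G \<and>
     openin (gtop G) = arbitrary union_of (\<lambda>B. B \<in> \<B>) \<and>
     (\<forall>M\<in>\<B>. \<forall>N\<in>\<B>. set_mul G M N \<in> \<B>) \<and> (\<forall>M\<in>\<B>. set_inv G M \<in> \<B>))"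

definition etale :: "'g top_groupoid \<Rightarrow> bool" where
  "etale G \<longleftrightarrow>
     continuous_map (gtop G) (gtop G) (ginv G) \<and>
     continuous_map
       (subtopology (prod_topology (gtop G) (gtop G))
          {(g, h). g \<in> elems G \<and> h \<in> elems G \<and> src G g = rng G h})
       (gtop G) (\<lambda>(g, h). the (mul G g h)) \<and>
     openin (gtop G) (gunits G) \<and>
     (\<forall>g\<in>elems G. \<exists>U. openin (gtop G) U \<and> g \<in> U \<and> openin (gtop G) (src G ` U) \<and>
        homeomorphic_map (subtopology (gtop G) U) (subtopology (gtop G) (src G ` U)) (src G))"

definition isomorphic_etale_groupoids :: "'g top_groupoid \<Rightarrow> 'h top_groupoid \<Rightarrow> bool" where
  "isomorphic_etale_groupoids G G' \<longleftrightarrow> etale G \<and> etale G' \<and>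
     (\<exists>\<psi>. bij_betw \<psi> (elems G) (elems G') \<and>
        (\<forall>g\<in>elems G. \<forall>h\<in>elems G. mul G' (\<psi> g) (\<psi> h) = map_option \<psi> (mul G g h)) \<and>
        homeomorphic_map (gtop G) (gtop G') \<psi>)"


section \<open>Semigroups of partial functions\<close>

definition partial_funs ::
    "('y, 'b) semigroupoid_scheme \<Rightarrow> 'g set set \<Rightarrow> ('g \<rightharpoonup> 'y) set" where
  "partial_funs Y \<X> = {a. dom a \<in> \<X> \<and> ran a \<subseteq> elems Y}"

definition preim :: "'y set \<Rightarrow> ('g \<rightharpoonup> 'y) \<Rightarrow> 'g set" where
  "preim W a = {g. \<exists>y\<in>W. a g = Some y}"

text \<open>\<open>m\<close> is the product of \<open>A\<close>. Apart from associativity it is constrained only when one factor has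
  a bisection as its domain; then \<open>k\<close> determines the factorisation \<open>k = gh\<close> in the last clause.\<close>

definition function_semigroup ::
    "'g top_groupoid \<Rightarrow> 'y semigroupoid \<Rightarrow> ('g \<rightharpoonup> 'y) set \<Rightarrow>
      (('g \<rightharpoonup> 'y) \<Rightarrow> ('g \<rightharpoonup> 'y) \<Rightarrow> ('g \<rightharpoonup> 'y)) \<Rightarrow> bool" where
  "function_semigroup G Y A m \<longleftrightarrow>
     A \<subseteq> partial_funs Y {U. openin (gtop G) U} \<and>
     (\<forall>a\<in>A. \<forall>b\<in>A. m a b \<in> A) \<and>
     (\<forall>a\<in>A. \<forall>b\<in>A. \<forall>c\<in>A. m (m a b) c = m a (m b c)) \<and>
     (\<forall>a\<in>A. \<forall>b\<in>A. bisection G (dom a) \<or> bisection G (dom b) \<longrightarrow>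
        (\<forall>k z. m a b k = Some z \<longleftrightarrow>
           (\<exists>g h x y. mul G g h = Some k \<and> a g = Some x \<and> b h = Some y \<and> mul Y x y = Some z)))"

definition subZ ::
    "'g top_groupoid \<Rightarrow> 'y semigroupoid \<Rightarrow> ('g \<rightharpoonup> 'y) set \<Rightarrow> ('g \<rightharpoonup> 'y) set" where
  "subZ G Y A = {a \<in> A. dom a \<subseteq> gunits G \<and> ran a \<subseteq> centre_of Y}"

definition subD :: "'g top_groupoid \<Rightarrow> ('g \<rightharpoonup> 'y) set \<Rightarrow> ('g \<rightharpoonup> 'y) set" where
  "subD G A = {a \<in> A. dom a \<subseteq> gunits G}"

definition subS :: "'g top_groupoid \<Rightarrow> ('g \<rightharpoonup> 'y) set \<Rightarrow> ('g \<rightharpoonup> 'y) set" where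
  "subS G A = {a \<in> A. bisection G (dom a)}"

definition subC :: "'g top_groupoid \<Rightarrow> ('g \<rightharpoonup> 'y) set \<Rightarrow> ('g \<rightharpoonup> 'y) set" where
  "subC G A = {a \<in> A. dom a \<subseteq> isotropy G}"

definition subN :: "'g top_groupoid \<Rightarrow> ('g \<rightharpoonup> 'y) set \<Rightarrow> ('g \<rightharpoonup> 'y) set" where
  "subN G A = {a \<in> A. isosection G (dom a)}"

definition subCRZ ::
    "'g top_groupoid \<Rightarrow> 'y semigroupoid \<Rightarrow> ('g \<rightharpoonup> 'y) set \<Rightarrow>
      (('g \<rightharpoonup> 'y) \<Rightarrow> ('g \<rightharpoonup> 'y) \<Rightarrow> ('g \<rightharpoonup> 'y)) \<Rightarrow> ('g \<rightharpoonup> 'y) set" where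
  "subCRZ G Y A m = {c \<in> subC G A. \<exists>c'\<in>subC G A.
     m c c' \<in> subZ G Y A \<and> m c' c \<in> subZ G Y A \<and>
     m (m c c') c = c \<and> m (m c' c) c' = c'}"

definition exhaustive ::
    "'g top_groupoid \<Rightarrow> 'y semigroupoid \<Rightarrow> ('g \<rightharpoonup> 'y) set \<Rightarrow> bool" where
  "exhaustive G Y D \<longleftrightarrow> (\<forall>g\<in>gunits G. \<forall>y\<in>elems Y. \<exists>d\<in>D. d g = Some y)"

text \<open>The five conjuncts after the first are, in order, 1-Proper, Urysohn, Involutive,
  Compact-Urysohn and Compact-Involutive. An equation \<open>a(h) = b(k)\<^sup>-\<^sup>1\<close> is read as including that
  both sides are defined.\<close>

definition compact_bumpy ::
    "'g top_groupoid \<Rightarrow> 'y semigroupoid \<Rightarrow> ('g \<rightharpoonup> 'y) set \<Rightarrow> bool" where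
  "compact_bumpy G Y S \<longleftrightarrow>
     S \<subseteq> partial_funs Y (open_bisections G) \<and>
     (\<forall>a\<in>S. compactin (gtop G) (preim {one_of Y} a)) \<and>
     (Map.empty \<in> S \<and>
      (\<forall>U g. openin (gtop G) U \<and> g \<in> U \<longrightarrow>
         (\<exists>a\<in>S. dom a \<subseteq> U \<and> g \<in> gtop G interior_of preim (invertibles Y) a))) \<and>
     (\<forall>a\<in>S. \<forall>g \<in> gtop G interior_of preim (invertibles Y) a.
        \<exists>b\<in>S. ginv G g \<in> gtop G interior_of
          {h \<in> elems G. \<exists>x y. a (ginv G h) = Some x \<and> b h = Some y \<and> inverse_of Y y x}) \<and>
     (\<forall>K\<in>compact_bisections G. \<forall>U\<in>open_bisections G. K \<subseteq> U \<longrightarrow>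
        (\<exists>a\<in>S. dom a \<subseteq> U \<and> K \<subseteq> preim (invertibles Y) a)) \<and>
     (\<forall>a\<in>S. \<forall>K. K \<subseteq> preim (invertibles Y) a \<and> compactin (gtop G) K \<longrightarrow>
        (\<exists>b\<in>S. \<forall>g\<in>K. \<exists>x y. a g = Some x \<and> b (ginv G g) = Some y \<and> inverse_of Y x y))"

definition diagonally_isomorphic ::
    "'g top_groupoid \<Rightarrow> ('g \<rightharpoonup> 'y) set \<Rightarrow> (('g \<rightharpoonup> 'y) \<Rightarrow> ('g \<rightharpoonup> 'y) \<Rightarrow> ('g \<rightharpoonup> 'y)) \<Rightarrow>
     'h top_groupoid \<Rightarrow> ('h \<rightharpoonup> 'z) set \<Rightarrow> (('h \<rightharpoonup> 'z) \<Rightarrow> ('h \<rightharpoonup> 'z) \<Rightarrow> ('h \<rightharpoonup> 'z)) \<Rightarrow> bool" where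
  "diagonally_isomorphic G A m G' A' m' \<longleftrightarrow>
     (\<exists>\<phi>. bij_betw \<phi> A A' \<and> (\<forall>a\<in>A. \<forall>b\<in>A. \<phi> (m a b) = m' (\<phi> a) (\<phi> b)) \<and>
          \<phi> ` subD G A = subD G' A')"

end

theory Submission
  imports Defs
begin

text \<open>
  The groupoid is recovered from its compact open bisections, and these are recovered from the
  semigroup \<open>A\<close> and its subset \<open>D\<close>.

  The key notion is that of a dual pair: \<open>a\<close> and \<open>a'\<close> with \<open>aa'a = a\<close> and \<open>a'aa' = a'\<close> such that \<open>aa'\<close>
  and \<open>a'a\<close> are central in \<open>D\<close> and both \<open>aDa'\<close> and \<open>a'Da\<close> are contained in \<open>D\<close>. Isomorphisms that
  respect \<open>D\<close> preserve this notion. The members of dual pairs are exactly the functions with invertible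
  values on a compact open bisection. That such functions have a dual, and exist on each compact open
  bisection, is what bumpiness gives (\<open>exists_dual\<close>). The converse (\<open>dual_bisection\<close>, \<open>dual_values\<close>,
  \<open>dual_dom\<close>) rests on the following observations.

  The central idempotents of \<open>D\<close> are the characteristic functions of the compact open sets of units,
  because the values of a central element are central and \<open>1\<close> is the only central idempotent of \<open>Y\<close>
  (\<open>central_idempotent_eq_chi\<close>). A dual pair conjugates these idempotents to each other, and as they
  separate units, the source and the range of \<open>g \<in> dom a\<close> determine each other (\<open>dual_range_eq\<close>,
  \<open>dual_source_eq\<close>). So \<open>a\<close> acts on units like a bisection, up to isotropy. The isotropy is removed by
  multiplying \<open>a\<close> with an element \<open>t\<close> that is supported on the inverse of a small bisection inside
  \<open>dom a\<close>: the product is supported in the isotropy and again has a dual, hence lies in the set that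
  is assumed to consist of functions on bisections.

  For \<open>a\<close> and \<open>b\<close> in dual pairs, \<open>dom a \<subseteq> dom b\<close> holds iff \<open>a \<in> Db\<close> (\<open>dom_subset_iff\<close>), and
  \<open>dom (ab)\<close> is the product of the two domains (\<open>dom_mul\<close>). So a diagonal isomorphism induces an
  isomorphism of ordered semigroups between the compact open bisections of the two groupoids. These
  are bases of compact sets which are Hausdorff because the unit spaces are, and an order isomorphism
  between such bases comes from a homeomorphism: points are ultrafilters in the basis
  (\<open>order_iso_of_bases_homeomorphism\<close>). The homeomorphism respects products because bisections
  separate elements with common source or range (\<open>products_transfer\<close>).
\<close>

section \<open>Groupoids\<close>

locale tgroupoid =
  fixes G :: "'g top_groupoid"
  assumes topologised_groupoid: "topologised_groupoid G"
begin

abbreviation s where "s \<equiv> src G"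
abbreviation r where "r \<equiv> rng G"
abbreviation inv where "inv \<equiv> ginv G"

lemma topspace_eq: "topspace (gtop G) = elems G"
  using topologised_groupoid by (simp add: topologised_groupoid_def)

lemma inv_closed [simp]: "g \<in> elems G \<Longrightarrow> inv g \<in> elems G"
  and inv_inv [simp]: "g \<in> elems G \<Longrightarrow> inv (inv g) = g"
  using topologised_groupoid unfolding topologised_groupoid_def by blast+

lemma mul_inv_left: "g \<in> elems G \<Longrightarrow> mul G (inv g) g = Some (s g)"
  using topologised_groupoid unfolding topologised_groupoid_def src_def by (metis option.collapse)

lemma mul_inv_right: "g \<in> elems G \<Longrightarrow> mul G g (inv g) = Some (r g)"
  using mul_inv_left[of "inv g"] by (simp add: rng_def)

lemma s_inv [simp]: "g \<in> elems G \<Longrightarrow> s (inv g) = r g"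
  and r_inv [simp]: "g \<in> elems G \<Longrightarrow> r (inv g) = s g"
  by (simp_all add: src_def rng_def)

lemma mul_closed: "mul G g h = Some k \<Longrightarrow> g \<in> elems G \<Longrightarrow> h \<in> elems G \<Longrightarrow> k \<in> elems G"
  and mul_cancel_left: "mul G g h = Some k \<Longrightarrow> g \<in> elems G \<Longrightarrow> h \<in> elems G \<Longrightarrow> mul G (inv g) k = Some h"
  and mul_cancel_right: "mul G g h = Some k \<Longrightarrow> g \<in> elems G \<Longrightarrow> h \<in> elems G \<Longrightarrow> mul G k (inv h) = Some g"
  using topologised_groupoid unfolding topologised_groupoid_def by blast+

lemma mul_defined_iff:
  "g \<in> elems G \<Longrightarrow> h \<in> elems G \<Longrightarrow> (\<exists>k. mul G g h = Some k) \<longleftrightarrow> s g = r h"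
  using groupoid_mul_defined_iff[OF topologised_groupoid, of g h] by auto

lemma s_closed [simp]: "g \<in> elems G \<Longrightarrow> s g \<in> elems G"
  using mul_closed[OF mul_inv_left] by simp

lemma r_closed [simp]: "g \<in> elems G \<Longrightarrow> r g \<in> elems G"
  using s_closed[of "inv g"] by simp

lemma mul_s [simp]: "g \<in> elems G \<Longrightarrow> mul G g (s g) = Some g"
  using mul_cancel_left[OF mul_inv_left, of g] by simp

lemma mul_r [simp]: "g \<in> elems G \<Longrightarrow> mul G (r g) g = Some g"
  using mul_cancel_right[OF mul_inv_right, of g] by simp

lemma mul_s_r:
  assumes "mul G g h = Some k" "g \<in> elems G" "h \<in> elems G"
  shows "s g = r h" "r k = r g" "s k = s h"
proof -
  show "s g = r h" using assms mul_defined_iff by blast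
  show "s k = s h"
    using mul_defined_iff[of k "inv h"] mul_cancel_right[OF assms] assms mul_closed by force
  show "r k = r g"
    using mul_defined_iff[of "inv g" k] mul_cancel_left[OF assms] assms mul_closed by force
qed

lemma r_s [simp]: "g \<in> elems G \<Longrightarrow> r (s g) = s g"
  and s_s [simp]: "g \<in> elems G \<Longrightarrow> s (s g) = s g"
  using mul_s_r[OF mul_inv_left, of g] by auto

lemma s_r [simp]: "g \<in> elems G \<Longrightarrow> s (r g) = r g"
  and r_r [simp]: "g \<in> elems G \<Longrightarrow> r (r g) = r g"
  using r_s[of "inv g"] s_s[of "inv g"] by auto

lemma gunits_subset: "gunits G \<subseteq> elems G"
  by (auto simp: gunits_def)

lemma s_gunits [simp]: "g \<in> elems G \<Longrightarrow> s g \<in> gunits G"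
  by (simp add: gunits_def)

lemma r_gunits [simp]: "g \<in> elems G \<Longrightarrow> r g \<in> gunits G"
  using s_gunits[of "inv g"] by simp

lemma gunits_s [simp]: "u \<in> gunits G \<Longrightarrow> s u = u"
  and gunits_r [simp]: "u \<in> gunits G \<Longrightarrow> r u = u"
  by (auto simp: gunits_def)

lemma gunits_elems [simp]: "u \<in> gunits G \<Longrightarrow> u \<in> elems G"
  using gunits_subset by auto

lemma mul_unit_left:
  assumes "u \<in> gunits G" "g \<in> elems G"
  shows "mul G u g = Some k \<longleftrightarrow> u = r g \<and> k = g"
  using assms mul_s_r(1)[of u g k] gunits_s[of u] mul_r[of g] gunits_elems[of u] by fastforce

lemma mul_unit_right:
  assumes "u \<in> gunits G" "g \<in> elems G"
  shows "mul G g u = Some k \<longleftrightarrow> u = s g \<and> k = g"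
  using assms mul_s_r(1)[of g u k] gunits_r[of u] mul_s[of g] gunits_elems[of u] by fastforce

lemma eq_if_mul_inv_unit:
  assumes "mul G g (inv h) = Some k" "k \<in> gunits G" "g \<in> elems G" "h \<in> elems G"
  shows "g = h"
  using mul_cancel_right[OF assms(1)] assms mul_unit_left by auto

lemma eq_if_inv_mul_unit:
  assumes "mul G (inv g) h = Some k" "k \<in> gunits G" "g \<in> elems G" "h \<in> elems G"
  shows "g = h"
  using mul_cancel_left[OF assms(1)] assms mul_unit_right by auto

text \<open>If \<open>s(g) = s(h)\<close> then \<open>gh\<inverse>\<close> is defined, and it is a unit only when \<open>g = h\<close>. So being a
  bisection means that source and range are injective.\<close>

lemma bisection_iff: "bisection G B \<longleftrightarrow> B \<subseteq> elems G \<and> inj_on s B \<and> inj_on r B"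
proof
  assume B: "bisection G B"
  then have sub: "B \<subseteq> elems G" by (simp add: bisection_def)
  have "g = h" if gh0: "g \<in> B" "h \<in> B" "s g = s h" for g h
  proof -
    have gh: "g \<in> elems G" "h \<in> elems G" using that sub by auto
    then obtain k where k: "mul G g (inv h) = Some k" using mul_defined_iff[of g "inv h"] gh0 by auto
    then have "k \<in> gunits G" using B gh0 unfolding bisection_def set_mul_def set_inv_def by blast
    then show ?thesis using eq_if_mul_inv_unit k gh by auto
  qed
  moreover have "g = h" if gh0: "g \<in> B" "h \<in> B" "r g = r h" for g h
  proof -
    have gh: "g \<in> elems G" "h \<in> elems G" using that sub by auto
    then obtain k where k: "mul G (inv g) h = Some k" using mul_defined_iff[of "inv g" h] gh0 by auto
    then have "k \<in> gunits G" using B gh0 unfolding bisection_def set_mul_def set_inv_def by blast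
    then show ?thesis using eq_if_inv_mul_unit k gh by auto
  qed
  ultimately show "B \<subseteq> elems G \<and> inj_on s B \<and> inj_on r B"
    using sub by (auto simp: inj_on_def)
next
  assume B: "B \<subseteq> elems G \<and> inj_on s B \<and> inj_on r B"
  have "k \<in> gunits G" if "g \<in> B" "h \<in> B" "mul G g (inv h) = Some k" for g h k
  proof -
    have gh: "g \<in> elems G" "h \<in> elems G" using that B by auto
    then have "s g = s h" using mul_s_r[OF that(3)] by auto
    then have "g = h" using B that by (auto simp: inj_on_def)
    then show ?thesis using that gh mul_inv_right by auto
  qed
  moreover have "k \<in> gunits G" if "g \<in> B" "h \<in> B" "mul G (inv g) h = Some k" for g h k
  proof -
    have gh: "g \<in> elems G" "h \<in> elems G" using that B by auto
    then have "r g = r h" using mul_s_r[OF that(3)] by auto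
    then have "g = h" using B that by (auto simp: inj_on_def)
    then show ?thesis using that gh mul_inv_left by auto
  qed
  ultimately show "bisection G B"
    using B unfolding bisection_def set_mul_def set_inv_def by blast
qed

lemma bisection_s_inj: "bisection G B \<Longrightarrow> g \<in> B \<Longrightarrow> h \<in> B \<Longrightarrow> s g = s h \<Longrightarrow> g = h"
  and bisection_r_inj: "bisection G B \<Longrightarrow> g \<in> B \<Longrightarrow> h \<in> B \<Longrightarrow> r g = r h \<Longrightarrow> g = h"
  and bisection_subset: "bisection G B \<Longrightarrow> B \<subseteq> elems G"
  unfolding bisection_iff by (blast dest: inj_onD)+

lemma bisection_units:
  assumes "B \<subseteq> gunits G"
  shows "bisection G B"
proof -
  have "inj_on s B" "inj_on r B"
    using assms gunits_s gunits_r by (metis inj_onI subsetD)+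
  then show ?thesis using assms gunits_subset unfolding bisection_iff by blast
qed

lemma mem_set_inv_iff: "B \<subseteq> elems G \<Longrightarrow> h \<in> set_inv G B \<longleftrightarrow> h \<in> elems G \<and> inv h \<in> B"
  unfolding set_inv_def image_iff using inv_inv inv_closed by (metis subsetD)

lemma bisection_set_mul:
  assumes B: "bisection G B" and C: "bisection G C"
  shows "bisection G (set_mul G B C)"
proof -
  have sub: "B \<subseteq> elems G" "C \<subseteq> elems G" using assms bisection_subset by auto
  have "k = k'" if k: "g \<in> B" "h \<in> C" "mul G g h = Some k" and k': "g' \<in> B" "h' \<in> C" "mul G g' h' = Some k'"
    and eq: "s k = s k' \<or> r k = r k'" for g h k g' h' k'
  proof -
    have el: "g \<in> elems G" "h \<in> elems G" "g' \<in> elems G" "h' \<in> elems G" using that sub by auto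
    note 1 = mul_s_r[OF k(3) el(1,2)] and 2 = mul_s_r[OF k'(3) el(3,4)]
    have "g = g' \<and> h = h'"
      using eq
    proof
      assume "s k = s k'"
      then have "h = h'" using 1 2 bisection_s_inj[OF C k(2) k'(2)] by simp
      then show ?thesis using 1 2 bisection_s_inj[OF B k(1) k'(1)] by simp
    next
      assume "r k = r k'"
      then have "g = g'" using 1 2 bisection_r_inj[OF B k(1) k'(1)] by simp
      then show ?thesis using 1 2 bisection_r_inj[OF C k(2) k'(2)] by simp
    qed
    then show ?thesis using k k' by simp
  qed
  then have "inj_on s (set_mul G B C)" "inj_on r (set_mul G B C)"
    unfolding set_mul_def by (blast intro: inj_onI)+
  moreover have "set_mul G B C \<subseteq> elems G"
    unfolding set_mul_def using sub mul_closed by blast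
  ultimately show ?thesis unfolding bisection_iff by blast
qed

lemma s_image_eq: "bisection G B \<Longrightarrow> s ` B = set_mul G (set_inv G B) B"
proof -
  assume B: "bisection G B"
  note sub = subsetD[OF bisection_subset[OF B]]
  have "s g \<in> set_mul G (set_inv G B) B" if "g \<in> B" for g
    unfolding set_mul_def set_inv_def using that mul_inv_left[OF sub[OF that]] by blast
  moreover have "k \<in> s ` B" if g: "g \<in> B" and h: "h \<in> B" and k: "mul G (inv g) h = Some k" for g h k
  proof -
    have "r g = r h" using mul_s_r(1)[OF k] g h sub by auto
    then have "g = h" using bisection_r_inj[OF B g h] by simp
    then show ?thesis using k mul_inv_left[OF sub[OF g]] g by auto
  qed
  ultimately show ?thesis unfolding set_mul_def set_inv_def by blast
qed

end

section \<open>Ample groupoids\<close>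

locale ample_groupoid = tgroupoid +
  assumes ample: "ample G"
    and Hausdorff_units: "Hausdorff_space (subtopology (gtop G) (gunits G))"
begin

definition cobs where "cobs = open_bisections G \<inter> compact_bisections G"

lemma cobsD:
  assumes "B \<in> cobs"
  shows "bisection G B" "openin (gtop G) B" "compactin (gtop G) B" "B \<subseteq> elems G"
  using assms bisection_subset by (auto simp: cobs_def open_bisections_def compact_bisections_def)

lemma cobsI: "bisection G B \<Longrightarrow> openin (gtop G) B \<Longrightarrow> compactin (gtop G) B \<Longrightarrow> B \<in> cobs"
  by (auto simp: cobs_def open_bisections_def compact_bisections_def)

lemma open_subset: "openin (gtop G) U \<Longrightarrow> U \<subseteq> elems G"
  using openin_subset topspace_eq by metis

lemma ample_basis:
  "\<exists>\<B>\<subseteq>cobs. (\<forall>U g. openin (gtop G) U \<longrightarrow> g \<in> U \<longrightarrow> (\<exists>M\<in>\<B>. g \<in> M \<and> M \<subseteq> U)) \<and>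
    (\<forall>M\<in>\<B>. \<forall>N\<in>\<B>. set_mul G M N \<in> \<B>) \<and> (\<forall>M\<in>\<B>. set_inv G M \<in> \<B>)"
proof -
  obtain \<B> where \<B>: "\<B> \<subseteq> cobs" "openin (gtop G) = arbitrary union_of (\<lambda>B. B \<in> \<B>)"
    "\<forall>M\<in>\<B>. \<forall>N\<in>\<B>. set_mul G M N \<in> \<B>" "\<forall>M\<in>\<B>. set_inv G M \<in> \<B>"
    using ample unfolding ample_def cobs_def by (elim exE conjE)
  have "\<forall>U g. openin (gtop G) U \<longrightarrow> g \<in> U \<longrightarrow> (\<exists>M\<in>\<B>. g \<in> M \<and> M \<subseteq> U)"
    unfolding \<B>(2) arbitrary_union_of_alt by blast
  then show ?thesis using \<B>(1,3,4) by blast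
qed

lemma open_set_mul:
  assumes "openin (gtop G) U" "openin (gtop G) V"
  shows "openin (gtop G) (set_mul G U V)"
proof (subst openin_subopen, intro ballI)
  fix k assume "k \<in> set_mul G U V"
  then obtain g h where gh: "g \<in> U" "h \<in> V" "mul G g h = Some k" by (auto simp: set_mul_def)
  obtain \<B> where \<B>: "\<B> \<subseteq> cobs"
    "\<forall>U g. openin (gtop G) U \<longrightarrow> g \<in> U \<longrightarrow> (\<exists>M\<in>\<B>. g \<in> M \<and> M \<subseteq> U)"
    "\<forall>M\<in>\<B>. \<forall>N\<in>\<B>. set_mul G M N \<in> \<B>" "\<forall>M\<in>\<B>. set_inv G M \<in> \<B>"
    using ample_basis by (elim exE conjE)
  obtain M where M: "M \<in> \<B>" "g \<in> M" "M \<subseteq> U"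
    using \<B>(2) assms(1) gh(1) by blast
  obtain N where N: "N \<in> \<B>" "h \<in> N" "N \<subseteq> V"
    using \<B>(2) assms(2) gh(2) by blast
  have "set_mul G M N \<in> \<B>" using \<B>(3) M(1) N(1) by blast
  then have "openin (gtop G) (set_mul G M N)" using cobsD(2) \<B>(1) by blast
  moreover have "k \<in> set_mul G M N" using M N gh by (auto simp: set_mul_def)
  moreover have "set_mul G M N \<subseteq> set_mul G U V" using M N by (auto simp: set_mul_def)
  ultimately show "\<exists>T. openin (gtop G) T \<and> k \<in> T \<and> T \<subseteq> set_mul G U V" by blast
qed

lemma cobs_nbhd:
  assumes "openin (gtop G) U" "g \<in> U"
  shows "\<exists>B\<in>cobs. set_inv G B \<in> cobs \<and> g \<in> B \<and> B \<subseteq> U"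
proof -
  obtain \<B> where \<B>: "\<B> \<subseteq> cobs"
    "\<forall>U g. openin (gtop G) U \<longrightarrow> g \<in> U \<longrightarrow> (\<exists>M\<in>\<B>. g \<in> M \<and> M \<subseteq> U)"
    "\<forall>M\<in>\<B>. \<forall>N\<in>\<B>. set_mul G M N \<in> \<B>" "\<forall>M\<in>\<B>. set_inv G M \<in> \<B>"
    using ample_basis by (elim exE conjE)
  obtain M where M: "M \<in> \<B>" "g \<in> M" "M \<subseteq> U"
    using \<B>(2) assms by blast
  show ?thesis using M \<B>(1) \<B>(4) M(1) by blast
qed

lemma open_set_inv:
  assumes "openin (gtop G) U"
  shows "openin (gtop G) (set_inv G U)"
proof (subst openin_subopen, intro ballI)
  fix k assume "k \<in> set_inv G U"
  then obtain g where g: "g \<in> U" "k = inv g" by (auto simp: set_inv_def)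
  obtain M where M: "set_inv G M \<in> cobs" "g \<in> M" "M \<subseteq> U" using cobs_nbhd[OF assms g(1)] by blast
  show "\<exists>T. openin (gtop G) T \<and> k \<in> T \<and> T \<subseteq> set_inv G U"
    using cobsD(2)[OF M(1)] M g by (intro exI[of _ "set_inv G M"]) (auto simp: set_inv_def)
qed

lemma open_gunits: "openin (gtop G) (gunits G)"
proof (subst openin_subopen, intro ballI)
  fix u assume u: "u \<in> gunits G"
  then have "u \<in> topspace (gtop G)" using topspace_eq by simp
  then obtain M where M: "M \<in> cobs" "u \<in> M" using cobs_nbhd[OF openin_topspace] by blast
  have "s ` M = set_mul G (set_inv G M) M" using s_image_eq cobsD(1)[OF M(1)] by blast
  then have "openin (gtop G) (s ` M)" using open_set_mul open_set_inv cobsD(2)[OF M(1)] by simp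
  moreover have "u \<in> s ` M" using M(2) gunits_s[OF u] by (metis imageI)
  moreover have "s ` M \<subseteq> gunits G" using cobsD(4)[OF M(1)] s_gunits by blast
  ultimately show "\<exists>T. openin (gtop G) T \<and> u \<in> T \<and> T \<subseteq> gunits G" by blast
qed

lemma continuous_s: "continuous_map (gtop G) (gtop G) s"
  unfolding continuous_map topspace_eq
proof (intro conjI allI impI)
  show "s ` elems G \<subseteq> elems G" using s_closed by blast
next
  fix U assume U: "openin (gtop G) U"
  have "{g \<in> elems G. s g \<in> U} = set_mul G (elems G) (U \<inter> gunits G)"
  proof (intro equalityI subsetI)
    fix g assume "g \<in> {g \<in> elems G. s g \<in> U}"
    then show "g \<in> set_mul G (elems G) (U \<inter> gunits G)"
      using mul_s s_gunits unfolding set_mul_def by blast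
  next
    fix g assume "g \<in> set_mul G (elems G) (U \<inter> gunits G)"
    then obtain x u where "x \<in> elems G" "u \<in> U" "u \<in> gunits G" "mul G x u = Some g"
      unfolding set_mul_def by blast
    then show "g \<in> {g \<in> elems G. s g \<in> U}" by (simp add: mul_unit_right)
  qed
  moreover have "openin (gtop G) (elems G)" using openin_topspace topspace_eq by metis
  ultimately show "openin (gtop G) {g \<in> elems G. s g \<in> U}"
    using open_set_mul openin_Int[OF U open_gunits] by presburger
qed

text \<open>On a bisection \<open>M\<close> the source map has image \<open>M\<inverse>M\<close>, an open set.\<close>

lemma open_s_image:
  assumes "openin (gtop G) U"
  shows "openin (gtop G) (s ` U)"
proof (subst openin_subopen, intro ballI)
  fix u assume "u \<in> s ` U"
  then obtain g where g: "g \<in> U" "u = s g" by blast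
  obtain M where M: "M \<in> cobs" "g \<in> M" "M \<subseteq> U" using cobs_nbhd[OF assms g(1)] by blast
  have "s ` M = set_mul G (set_inv G M) M" using s_image_eq cobsD(1)[OF M(1)] by blast
  then have "openin (gtop G) (s ` M)" using open_set_mul open_set_inv cobsD(2)[OF M(1)] by simp
  then show "\<exists>T. openin (gtop G) T \<and> u \<in> T \<and> T \<subseteq> s ` U" using M g by blast
qed

lemma s_homeomorphic_map:
  assumes B: "bisection G B" "openin (gtop G) B"
  shows "homeomorphic_map (subtopology (gtop G) B) (subtopology (gtop G) (s ` B)) s"
proof (rule bijective_open_imp_homeomorphic_map)
  have sub: "B \<subseteq> topspace (gtop G)" "s ` B \<subseteq> topspace (gtop G)"
    using B(2) open_s_image[OF B(2)] openin_subset by blast+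
  show "continuous_map (subtopology (gtop G) B) (subtopology (gtop G) (s ` B)) s"
    unfolding continuous_map_in_subtopology
    using continuous_map_from_subtopology[OF continuous_s] by auto
  show "open_map (subtopology (gtop G) B) (subtopology (gtop G) (s ` B)) s"
    unfolding open_map_def openin_open_subtopology[OF B(2)]
      openin_open_subtopology[OF open_s_image[OF B(2)]]
    using open_s_image by blast
  show "s ` topspace (subtopology (gtop G) B) = topspace (subtopology (gtop G) (s ` B))"
    by (simp only: topspace_subtopology_subset[OF sub(1)] topspace_subtopology_subset[OF sub(2)])
  show "inj_on s (topspace (subtopology (gtop G) B))"
    using B(1) unfolding topspace_subtopology_subset[OF sub(1)] bisection_iff by blast
qed

text \<open>The source map embeds an open bisection in the unit space, so compactness, as well as the Hausdorff
  property below, can be tested there, although \<open>G\<close> itself may fail to be Hausdorff.\<close>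

lemma compact_bisection_if_source_compact:
  assumes "bisection G B" "openin (gtop G) B" "compactin (gtop G) (s ` B)"
  shows "B \<in> cobs"
proof (rule cobsI[OF assms(1,2)])
  have "subtopology (gtop G) B homeomorphic_space subtopology (gtop G) (s ` B)"
    using s_homeomorphic_map[OF assms(1,2)] homeomorphic_map_imp_homeomorphic_space by blast
  then have "compact_space (subtopology (gtop G) B)"
    using assms(3) homeomorphic_compact_space compactin_subspace by metis
  then show "compactin (gtop G) B"
    using openin_subset[OF assms(2)] by (simp add: compactin_subspace)
qed

lemma Hausdorff_bisection:
  assumes "bisection G B"
  shows "Hausdorff_space (subtopology (gtop G) B)"
proof (rule Hausdorff_space_injective_preimage[OF Hausdorff_units])
  note sub = bisection_subset[OF assms]
  show "continuous_map (subtopology (gtop G) B) (subtopology (gtop G) (gunits G)) s"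
    unfolding continuous_map_in_subtopology
    using continuous_map_from_subtopology[OF continuous_s] sub s_gunits by auto
  show "inj_on s (topspace (subtopology (gtop G) B))"
    using assms sub unfolding bisection_iff by (simp add: topspace_eq Int_absorb1)
qed

lemma separate_units:
  assumes "u \<in> gunits G" "v \<in> gunits G" "u \<noteq> v"
  shows "\<exists>K\<in>cobs. K \<subseteq> gunits G \<and> u \<in> K \<and> v \<notin> K"
proof -
  have "topspace (subtopology (gtop G) (gunits G)) = gunits G"
    using gunits_subset by (simp add: topspace_eq Int_absorb1)
  then obtain U V where UV: "openin (subtopology (gtop G) (gunits G)) U"
    "u \<in> U" "v \<in> V" "disjnt U V"
    using Hausdorff_units assms unfolding Hausdorff_space_def by metis
  then have "openin (gtop G) U" "U \<subseteq> gunits G" using openin_open_subtopology[OF open_gunits] by blast+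
  then show ?thesis using cobs_nbhd[OF _ UV(2)] UV(3,4) unfolding disjnt_iff by (metis subset_iff)
qed

text \<open>Continuity of multiplication at \<open>(g,h)\<close> with \<open>gh \<in> U\<close>: for an open bisection \<open>M\<close> around \<open>g\<close>, the
  set \<open>M\<inverse>U\<close> is an open neighbourhood of \<open>h\<close>, and \<open>M(M\<inverse>U) \<subseteq> U\<close>.\<close>

theorem etale: "etale G"
  unfolding etale_def
proof (intro conjI)
  show "openin (gtop G) (gunits G)" by (rule open_gunits)
  show "continuous_map (gtop G) (gtop G) inv"
    unfolding continuous_map topspace_eq
  proof (intro conjI allI impI)
    show "inv ` elems G \<subseteq> elems G" using inv_closed by blast
    fix U assume U: "openin (gtop G) U"
    have "{g \<in> elems G. inv g \<in> U} = set_inv G U"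
      using mem_set_inv_iff[OF open_subset[OF U]] by blast
    then show "openin (gtop G) {g \<in> elems G. inv g \<in> U}" using open_set_inv[OF U] by simp
  qed
  show "\<forall>g\<in>elems G. \<exists>U. openin (gtop G) U \<and> g \<in> U \<and> openin (gtop G) (s ` U) \<and>
        homeomorphic_map (subtopology (gtop G) U) (subtopology (gtop G) (s ` U)) s"
  proof
    fix g assume "g \<in> elems G"
    then have "g \<in> topspace (gtop G)" using topspace_eq by simp
    then obtain M where "M \<in> cobs" "g \<in> M" using cobs_nbhd[OF openin_topspace] by blast
    then show "\<exists>U. openin (gtop G) U \<and> g \<in> U \<and> openin (gtop G) (s ` U) \<and>
        homeomorphic_map (subtopology (gtop G) U) (subtopology (gtop G) (s ` U)) s"
      using cobsD(1,2) open_s_image s_homeomorphic_map by blast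
  qed
  let ?C = "{(g, h). g \<in> elems G \<and> h \<in> elems G \<and> src G g = rng G h}"
  let ?P = "prod_topology (gtop G) (gtop G)"
  have sub: "?C \<subseteq> topspace ?P" by (auto simp: topspace_eq)
  have mul: "mul G g h = Some (the (mul G g h))" if "(g, h) \<in> ?C" for g h
    using that mul_defined_iff[of g h] by auto
  show "continuous_map (subtopology ?P ?C) (gtop G) (\<lambda>(g, h). the (mul G g h))"
    unfolding continuous_map topspace_subtopology_subset[OF sub] topspace_eq
  proof (intro conjI allI impI)
    have "the (mul G g h) \<in> elems G" if "(g, h) \<in> ?C" for g h
      using mul_closed[OF mul[OF that]] that by auto
    then show "(\<lambda>(g, h). the (mul G g h)) ` ?C \<subseteq> elems G" by auto
  next
    fix U assume U: "openin (gtop G) U"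
    show "openin (subtopology ?P ?C) {x \<in> ?C. (case x of (g, h) \<Rightarrow> the (mul G g h)) \<in> U}" (is "openin _ ?W")
    proof (subst openin_subopen, intro ballI)
      fix p assume p: "p \<in> ?W"
      obtain g h where gh: "p = (g, h)" "(g, h) \<in> ?C" "the (mul G g h) \<in> U" using p by auto
      then have el: "g \<in> elems G" "h \<in> elems G" by auto
      then have "g \<in> topspace (gtop G)" using topspace_eq by simp
      then obtain M where M: "M \<in> cobs" "g \<in> M" using cobs_nbhd[OF openin_topspace] by blast
      let ?N = "set_mul G (set_inv G M) U"
      have "h \<in> ?N"
        using mul_cancel_left[OF mul[OF gh(2)] el] M(2) gh(3) unfolding set_mul_def set_inv_def by blast
      moreover have "openin (gtop G) ?N" using open_set_mul open_set_inv cobsD(2)[OF M(1)] U by blast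
      moreover have "the (mul G x y) \<in> U" if xy: "x \<in> M" "y \<in> ?N" "(x, y) \<in> ?C" for x y
      proof -
        obtain k u where k: "k \<in> M" "u \<in> U" "mul G (inv k) u = Some y"
          using xy(2) unfolding set_mul_def set_inv_def by blast
        have el: "k \<in> elems G" "u \<in> elems G" "x \<in> elems G" "inv k \<in> elems G"
          using k xy cobsD(4)[OF M(1)] open_subset[OF U] inv_closed by blast+
        have "r y = s k" using mul_s_r(2)[OF k(3)] el by simp
        then have "s x = s k" using xy(3) by simp
        then have "x = k" using bisection_s_inj[OF cobsD(1)[OF M(1)] xy(1) k(1)] by simp
        moreover have "mul G k y = Some u" using mul_cancel_left[OF k(3) el(4) el(2)] el(1) by simp
        ultimately show ?thesis using k(2) by simp
      qed
      ultimately show "\<exists>T. openin (subtopology ?P ?C) T \<and> p \<in> T \<and> T \<subseteq> ?W"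
        using cobsD(2)[OF M(1)] M(2) gh
        by (intro exI[of _ "?C \<inter> M \<times> ?N"])
          (auto simp: openin_prod_Times_iff intro!: openin_subtopology_Int2)
    qed
  qed
qed

end

section \<open>Spaces determined by the order on a basis\<close>

text \<open>A basis as the compact open bisections provide it: every member is compact and Hausdorff in the
  subspace topology, while the union of two members need not be Hausdorff. The points of such a
  space are the ultrafilters of the ordered set \<open>(\<K>, \<subseteq>)\<close>. The empty set is required to be a member
  so that an order isomorphism, which preserves the least element, preserves properness of filters.\<close>

locale compact_Hausdorff_basis =
  fixes X :: "'a topology" and \<K> :: "'a set set"
  assumes open_K: "K \<in> \<K> \<Longrightarrow> openin X K"
    and compact_K: "K \<in> \<K> \<Longrightarrow> compactin X K"
    and Hausdorff_K: "K \<in> \<K> \<Longrightarrow> Hausdorff_space (subtopology X K)"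
    and basis: "openin X U \<Longrightarrow> x \<in> U \<Longrightarrow> \<exists>K\<in>\<K>. x \<in> K \<and> K \<subseteq> U"
    and empty_K: "{} \<in> \<K>"
begin

lemma refine: "K \<in> \<K> \<Longrightarrow> L \<in> \<K> \<Longrightarrow> x \<in> K \<Longrightarrow> x \<in> L \<Longrightarrow> \<exists>M\<in>\<K>. x \<in> M \<and> M \<subseteq> K \<inter> L"
  using basis[of "K \<inter> L" x] open_K by blast

lemma covered: "x \<in> topspace X \<Longrightarrow> \<exists>K\<in>\<K>. x \<in> K"
  using basis[OF openin_topspace] by blast

text \<open>Both points lie in one member of the basis, and that member is Hausdorff.\<close>

lemma eq_if_nbhds_subset:
  assumes x: "x \<in> topspace X" and xy: "\<And>K. K \<in> \<K> \<Longrightarrow> x \<in> K \<Longrightarrow> y \<in> K"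
  shows "x = y"
proof (rule ccontr)
  assume "x \<noteq> y"
  obtain K where K: "K \<in> \<K>" "x \<in> K" using covered[OF x] by blast
  then have "y \<in> K" using xy by blast
  moreover have "topspace (subtopology X K) = K"
    using openin_subset[OF open_K[OF K(1)]] by (simp add: Int_absorb1)
  ultimately obtain U V where UV: "openin (subtopology X K) U" "x \<in> U" "y \<in> V" "disjnt U V"
    using Hausdorff_K[OF K(1)] K(2) \<open>x \<noteq> y\<close> unfolding Hausdorff_space_def by metis
  have "openin X U" using UV(1) openin_open_subtopology[OF open_K[OF K(1)]] by blast
  then obtain L where "L \<in> \<K>" "x \<in> L" "L \<subseteq> U" using basis[OF _ UV(2)] by blast
  then show False using xy UV(3,4) unfolding disjnt_iff by blast
qed

text \<open>Below a fixed member of the filter base everything happens in a compact Hausdorff space,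
  where the other members are compact, hence closed.\<close>

lemma filter_base_has_common_point:
  assumes F: "F \<subseteq> \<K>" "F \<noteq> {}" "{} \<notin> F" and down: "\<And>K L. K \<in> F \<Longrightarrow> L \<in> F \<Longrightarrow> \<exists>M\<in>F. M \<subseteq> K \<inter> L"
  shows "\<exists>x\<in>topspace X. \<forall>K\<in>F. x \<in> K"
proof -
  obtain K where K: "K \<in> F" using F(2) by blast
  define F0 where "F0 = {M \<in> F. M \<subseteq> K}"
  have "K \<in> \<K>" using K F(1) by blast
  have cpt: "compact_space (subtopology X K)"
    using compact_K[OF \<open>K \<in> \<K>\<close>] by (simp add: compactin_subspace)
  have closed: "closedin (subtopology X K) M" if "M \<in> F0" for M
  proof (rule compactin_imp_closedin[OF Hausdorff_K[OF \<open>K \<in> \<K>\<close>]])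
    have "compactin X M" "M \<subseteq> K" using that F(1) compact_K unfolding F0_def by blast+
    then show "compactin (subtopology X K) M" by (simp add: compactin_subtopology)
  qed
  \<comment> \<open>A finite family in a filter base has a common lower bound in the base, and that is not empty.\<close>
  have fip: "\<exists>M\<in>F. M \<subseteq> \<Inter>\<C>" if "finite \<C>" "\<C> \<subseteq> F0" for \<C>
    using that
  proof (induction \<C>)
    case empty
    then show ?case using K by auto
  next
    case (insert L \<C>)
    then obtain M where "M \<in> F" "M \<subseteq> \<Inter>\<C>" by auto
    moreover have "L \<in> F" using insert.prems unfolding F0_def by blast
    ultimately obtain M' where "M' \<in> F" "M' \<subseteq> L \<inter> M" using down by blast
    then show ?case using \<open>M \<subseteq> \<Inter>\<C>\<close> by (intro bexI[of _ M']) auto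
  qed
  have "\<Inter>\<C> \<noteq> {}" if \<C>: "finite \<C>" "\<C> \<subseteq> F0" for \<C>
  proof
    assume "\<Inter>\<C> = {}"
    moreover obtain M where "M \<in> F" "M \<subseteq> \<Inter>\<C>" using fip[OF \<C>] by blast
    ultimately show False using F(3) by simp
  qed
  then have "(\<forall>C\<in>F0. closedin (subtopology X K) C) \<and> (\<forall>\<C>. finite \<C> \<and> \<C> \<subseteq> F0 \<longrightarrow> \<Inter>\<C> \<noteq> {})"
    using closed by simp
  then have "\<Inter>F0 \<noteq> {}" using spec[OF iffD1[OF compact_space_fip cpt], of F0] by (rule rev_mp)
  then obtain x where x: "\<And>M. M \<in> F0 \<Longrightarrow> x \<in> M" by blast
  have "K \<in> F0" using K unfolding F0_def by blast
  then have "x \<in> K" by (rule x)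
  then have "x \<in> topspace X" using open_K[OF \<open>K \<in> \<K>\<close>] openin_subset by blast
  moreover have "x \<in> L" if L: "L \<in> F" for L
  proof -
    obtain M where "M \<in> F" "M \<subseteq> K \<inter> L" using down[OF K L] by blast
    then show ?thesis using x[of M] unfolding F0_def by blast
  qed
  ultimately show ?thesis by blast
qed

end

text \<open>The image of the neighbourhood filter of \<open>x\<close> is a proper filter base, hence has a common point.\<close>

lemma order_iso_point_subset:
  assumes "compact_Hausdorff_basis X \<K>" "compact_Hausdorff_basis X' \<K>'"
    and bij: "bij_betw \<Phi> \<K> \<K>'" and mono: "\<And>K L. K \<in> \<K> \<Longrightarrow> L \<in> \<K> \<Longrightarrow> \<Phi> K \<subseteq> \<Phi> L \<longleftrightarrow> K \<subseteq> L"
    and x: "x \<in> topspace X"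
  shows "\<exists>y\<in>topspace X'. \<forall>K\<in>\<K>. x \<in> K \<longrightarrow> y \<in> \<Phi> K"
proof -
  interpret X: compact_Hausdorff_basis X \<K> by fact
  interpret X': compact_Hausdorff_basis X' \<K>' by fact
  let ?F = "\<Phi> ` {K \<in> \<K>. x \<in> K}"
  have 1: "{} \<notin> ?F"
  proof
    assume "{} \<in> ?F"
    then obtain K where K: "K \<in> \<K>" "x \<in> K" "\<Phi> K = {}" by auto
    then have "K \<subseteq> {}" using mono[OF K(1) X.empty_K] by simp
    then show False using K(2) by blast
  qed
  have 2: "?F \<subseteq> \<K>'" using bij_betw_imp_surj_on[OF bij] by blast
  have 3: "?F \<noteq> {}" using X.covered[OF x] by blast
  have 4: "\<exists>M\<in>?F. M \<subseteq> K \<inter> L" if F: "K \<in> ?F" "L \<in> ?F" for K L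
  proof -
    obtain K0 L0 where KL: "K0 \<in> \<K>" "x \<in> K0" "K = \<Phi> K0" "L0 \<in> \<K>" "x \<in> L0" "L = \<Phi> L0"
      using F by blast
    obtain M where "M \<in> \<K>" "x \<in> M" "M \<subseteq> K0 \<inter> L0" using X.refine KL by metis
    then show ?thesis using mono KL by (intro bexI[of _ "\<Phi> M"]) auto
  qed
  have "\<exists>y\<in>topspace X'. \<forall>K\<in>?F. y \<in> K"
    by (rule X'.filter_base_has_common_point[OF 2 3 1 4])
  then show ?thesis by blast
qed

text \<open>Neighbourhood filters are maximal among filters in the basis, so transporting a
  neighbourhood filter forth and back can only return the filter itself.\<close>

lemma order_iso_point:
  assumes X: "compact_Hausdorff_basis X \<K>" and X': "compact_Hausdorff_basis X' \<K>'"
    and bij: "bij_betw \<Phi> \<K> \<K>'" and mono: "\<And>K L. K \<in> \<K> \<Longrightarrow> L \<in> \<K> \<Longrightarrow> \<Phi> K \<subseteq> \<Phi> L \<longleftrightarrow> K \<subseteq> L"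
    and x: "x \<in> topspace X"
  shows "\<exists>y\<in>topspace X'. \<forall>K\<in>\<K>. x \<in> K \<longleftrightarrow> y \<in> \<Phi> K"
proof -
  obtain y where y: "y \<in> topspace X'" "\<And>K. K \<in> \<K> \<Longrightarrow> x \<in> K \<Longrightarrow> y \<in> \<Phi> K"
    using order_iso_point_subset[OF X X' bij mono x] by blast
  let ?\<Psi> = "inv_into \<K> \<Phi>"
  have \<Psi>: "bij_betw ?\<Psi> \<K>' \<K>" using bij bij_betw_inv_into by blast
  have \<Psi>_mem: "?\<Psi> K \<in> \<K>" "\<Phi> (?\<Psi> K) = K" if "K \<in> \<K>'" for K
    using that bij bij_betw_inv_into_right bij_betw_apply[OF \<Psi>] by metis+
  have "?\<Psi> K \<subseteq> ?\<Psi> L \<longleftrightarrow> K \<subseteq> L" if "K \<in> \<K>'" "L \<in> \<K>'" for K L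
    using mono[of "?\<Psi> K" "?\<Psi> L"] \<Psi>_mem that by simp
  then obtain z where z: "z \<in> topspace X" "\<And>K. K \<in> \<K>' \<Longrightarrow> y \<in> K \<Longrightarrow> z \<in> ?\<Psi> K"
    using order_iso_point_subset[OF X' X \<Psi> _ y(1)] by blast
  have z': "z \<in> K" if "K \<in> \<K>" "y \<in> \<Phi> K" for K
    using z(2)[of "\<Phi> K"] that bij bij_betw_inv_into_left bij_betw_apply by metis
  then have "x = z" using compact_Hausdorff_basis.eq_if_nbhds_subset[OF X x] y(2) by blast
  then show ?thesis using y z' by blast
qed

theorem order_iso_of_bases_homeomorphism:
  assumes X: "compact_Hausdorff_basis X \<K>" and X': "compact_Hausdorff_basis X' \<K>'"
    and bij: "bij_betw \<Phi> \<K> \<K>'" and mono: "\<And>K L. K \<in> \<K> \<Longrightarrow> L \<in> \<K> \<Longrightarrow> \<Phi> K \<subseteq> \<Phi> L \<longleftrightarrow> K \<subseteq> L"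
  shows "\<exists>\<psi>. homeomorphic_map X X' \<psi> \<and> (\<forall>K\<in>\<K>. \<psi> ` K = \<Phi> K)"
proof -
  interpret X: compact_Hausdorff_basis X \<K> by fact
  interpret X': compact_Hausdorff_basis X' \<K>' by fact
  have \<Phi>: "\<Phi> K \<in> \<K>'" if "K \<in> \<K>" for K using that bij bij_betw_apply by metis
  have \<Phi>_surj: "\<exists>L\<in>\<K>. K = \<Phi> L" if "K \<in> \<K>'" for K
    using that bij_betw_imp_surj_on[OF bij] by blast
  have "\<forall>x\<in>topspace X. \<exists>y. y \<in> topspace X' \<and> (\<forall>K\<in>\<K>. x \<in> K \<longleftrightarrow> y \<in> \<Phi> K)"
    using order_iso_point[OF X X' bij mono] by blast
  from bchoice[OF this]
  obtain \<psi> where \<psi>: "\<forall>x\<in>topspace X. \<psi> x \<in> topspace X' \<and> (\<forall>K\<in>\<K>. x \<in> K \<longleftrightarrow> \<psi> x \<in> \<Phi> K)"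
    by blast
  then have \<psi>_top: "\<psi> x \<in> topspace X'" and \<psi>_iff: "K \<in> \<K> \<Longrightarrow> x \<in> K \<longleftrightarrow> \<psi> x \<in> \<Phi> K"
    if "x \<in> topspace X" for x K using that by blast+
  let ?\<Psi> = "inv_into \<K> \<Phi>"
  have \<Psi>: "bij_betw ?\<Psi> \<K>' \<K>" using bij bij_betw_inv_into by blast
  have \<Psi>_mem: "?\<Psi> K \<in> \<K>" "\<Phi> (?\<Psi> K) = K" if "K \<in> \<K>'" for K
    using that bij bij_betw_inv_into_right bij_betw_apply[OF \<Psi>] by metis+
  have \<Psi>_mono: "?\<Psi> K \<subseteq> ?\<Psi> L \<longleftrightarrow> K \<subseteq> L" if "K \<in> \<K>'" "L \<in> \<K>'" for K L
    using mono[of "?\<Psi> K" "?\<Psi> L"] \<Psi>_mem that by simp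
  have inj: "inj_on \<psi> (topspace X)"
    using X.eq_if_nbhds_subset \<psi>_iff by (intro inj_onI) metis
  have surj: "\<exists>x\<in>topspace X. \<psi> x = y" if y: "y \<in> topspace X'" for y
  proof -
    obtain x where x: "x \<in> topspace X" "\<And>K. K \<in> \<K>' \<Longrightarrow> y \<in> K \<longleftrightarrow> x \<in> ?\<Psi> K"
      using order_iso_point[OF X' X \<Psi> \<Psi>_mono y] by blast
    have "y = \<psi> x"
    proof (rule X'.eq_if_nbhds_subset[OF y])
      fix K assume K: "K \<in> \<K>'" "y \<in> K"
      then have "x \<in> ?\<Psi> K" using x(2) by blast
      then show "\<psi> x \<in> K" using \<psi>_iff[OF x(1) \<Psi>_mem(1)[OF K(1)]] \<Psi>_mem(2)[OF K(1)] by simp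
    qed
    then show ?thesis using x(1) by blast
  qed
  have img: "\<psi> ` K = \<Phi> K" if K: "K \<in> \<K>" for K
  proof (intro equalityI subsetI)
    have sub: "K \<subseteq> topspace X" using X.open_K[OF K] openin_subset by blast
    fix y
    show "y \<in> \<Phi> K" if "y \<in> \<psi> ` K" using that sub \<psi>_iff[OF _ K] by blast
    assume y: "y \<in> \<Phi> K"
    then have "y \<in> topspace X'" using X'.open_K[OF \<Phi>[OF K]] openin_subset by blast
    then obtain x where "x \<in> topspace X" "\<psi> x = y" using surj by blast
    then show "y \<in> \<psi> ` K" using \<psi>_iff[OF _ K] y by blast
  qed
  have "homeomorphic_map X X' \<psi>"
  proof (rule bijective_open_imp_homeomorphic_map)
    show "\<psi> ` topspace X = topspace X'" using \<psi>_top surj by blast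
    show "inj_on \<psi> (topspace X)" by (rule inj)
    show "open_map X X' \<psi>"
      unfolding open_map_def
    proof (intro allI impI)
      fix U assume U: "openin X U"
      show "openin X' (\<psi> ` U)"
      proof (subst openin_subopen, intro ballI)
        fix y assume "y \<in> \<psi> ` U"
        then obtain x where x: "x \<in> U" "y = \<psi> x" by blast
        obtain K where "K \<in> \<K>" "x \<in> K" "K \<subseteq> U" using X.basis[OF U x(1)] by blast
        then have "y \<in> \<psi> ` K" "\<psi> ` K \<subseteq> \<psi> ` U" using x by blast+
        moreover have "openin X' (\<psi> ` K)"
          unfolding img[OF \<open>K \<in> \<K>\<close>] by (rule X'.open_K[OF \<Phi>[OF \<open>K \<in> \<K>\<close>]])
        ultimately show "\<exists>T. openin X' T \<and> y \<in> T \<and> T \<subseteq> \<psi> ` U" by blast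
      qed
    qed
    show "continuous_map X X' \<psi>"
      unfolding continuous_map
    proof (intro conjI allI impI)
      show "\<psi> ` topspace X \<subseteq> topspace X'" using \<psi>_top by blast
      fix U assume U: "openin X' U"
      show "openin X {x \<in> topspace X. \<psi> x \<in> U}"
      proof (subst openin_subopen, intro ballI)
        fix x assume x: "x \<in> {x \<in> topspace X. \<psi> x \<in> U}"
        then obtain K' where K': "K' \<in> \<K>'" "\<psi> x \<in> K'" "K' \<subseteq> U" using X'.basis[OF U] by blast
        obtain K where K: "K \<in> \<K>" "K' = \<Phi> K" using \<Phi>_surj[OF K'(1)] by blast
        have "openin X K" "K \<subseteq> topspace X" using X.open_K[OF K(1)] openin_subset by blast+
        moreover have "x \<in> K" using \<psi>_iff[OF _ K(1)] x K' K(2) by blast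
        moreover have "\<psi> ` K \<subseteq> U" using img[OF K(1)] K(2) K'(3) by simp
        ultimately show "\<exists>T. openin X T \<and> x \<in> T \<and> T \<subseteq> {x \<in> topspace X. \<psi> x \<in> U}" by blast
      qed
    qed
  qed
  then show ?thesis using img by blast
qed

section \<open>Dual pairs in a semigroup with a distinguished subset\<close>

text \<open>The centre of \<open>D\<close>, relative to a product that lives on a larger set.\<close>

definition commuting_part :: "'a set \<Rightarrow> ('a \<Rightarrow> 'a \<Rightarrow> 'a) \<Rightarrow> 'a set" where
  "commuting_part D m = {z \<in> D. \<forall>d\<in>D. m z d = m d z}"

text \<open>The algebraic stand-in for a function with invertible values on a compact open bisection, together
  with its pointwise inverse on the inverse bisection: \<open>a\<close> and \<open>a'\<close> are inverse to each other in the
  sense of inverse semigroups, the idempotents \<open>aa'\<close> and \<open>a'a\<close> are central in \<open>D\<close>, and \<open>a\<close>, \<open>a'\<close>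
  normalise \<open>D\<close>. The notion is purely algebraic, so every isomorphism that respects \<open>D\<close>
  preserves dual pairs.\<close>

definition dual_pair :: "'a set \<Rightarrow> 'a set \<Rightarrow> ('a \<Rightarrow> 'a \<Rightarrow> 'a) \<Rightarrow> 'a \<Rightarrow> 'a \<Rightarrow> bool" where
  "dual_pair A D m a a' \<longleftrightarrow> a \<in> A \<and> a' \<in> A \<and>
     m a a' \<in> commuting_part D m \<and> m a' a \<in> commuting_part D m \<and>
     m (m a a') a = a \<and> m (m a' a) a' = a' \<and>
     (\<forall>d\<in>D. m (m a d) a' \<in> D \<and> m (m a' d) a \<in> D)"

lemma dual_pair_sym: "dual_pair A D m a a' \<Longrightarrow> dual_pair A D m a' a"
  unfolding dual_pair_def by blast

lemma dual_pair_hom: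
  assumes "D \<subseteq> A" "\<And>a. a \<in> A \<Longrightarrow> \<phi> a \<in> A'" "\<And>a b. a \<in> A \<Longrightarrow> b \<in> A \<Longrightarrow> \<phi> (m a b) = m' (\<phi> a) (\<phi> b)"
    "\<And>a b. a \<in> A \<Longrightarrow> b \<in> A \<Longrightarrow> m a b \<in> A" "\<phi> ` D = D'"
    and a: "dual_pair A D m a a'"
  shows "dual_pair A' D' m' (\<phi> a) (\<phi> a')"
proof -
  have aA: "a \<in> A" "a' \<in> A" using a unfolding dual_pair_def by blast+
  have D': "\<exists>x\<in>D. d = \<phi> x" if "d \<in> D'" for d using that assms(5) by blast
  have D: "\<phi> x \<in> D'" if "x \<in> D" for x using that assms(5) by blast
  have Z: "\<phi> z \<in> commuting_part D' m'" if z: "z \<in> commuting_part D m" for z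
  proof -
    have "m' (\<phi> z) d = m' d (\<phi> z)" if d: "d \<in> D'" for d
    proof -
      obtain x where x: "x \<in> D" "d = \<phi> x" using D'[OF d] by blast
      then have "m z x = m x z" "z \<in> A" "x \<in> A" using z assms(1) unfolding commuting_part_def by blast+
      then show ?thesis using assms(3)[of z x] assms(3)[of x z] x(2) by simp
    qed
    then show ?thesis using z D unfolding commuting_part_def by blast
  qed
  have conj: "m' (m' (\<phi> b) d) (\<phi> b') \<in> D'" if b: "b \<in> A" "b' \<in> A" "\<And>d. d \<in> D \<Longrightarrow> m (m b d) b' \<in> D" and d: "d \<in> D'" for b b' d
  proof -
    obtain x where x: "x \<in> D" "d = \<phi> x" using D'[OF d] by blast
    then have "x \<in> A" using assms(1) by blast
    then have "m' (m' (\<phi> b) d) (\<phi> b') = \<phi> (m (m b x) b')" using assms(3,4) b(1,2) x(2) by simp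
    then show ?thesis using b(3)[OF x(1)] D by simp
  qed
  have eq: "m' (m' (\<phi> b) (\<phi> b')) (\<phi> b) = \<phi> b" if "b \<in> A" "b' \<in> A" "m (m b b') b = b" for b b'
    using assms(3)[of "m b b'" b] assms(3)[of b b'] assms(4)[of b b'] that by simp
  show ?thesis
    unfolding dual_pair_def
  proof (intro conjI ballI)
    show "\<phi> a \<in> A'" "\<phi> a' \<in> A'" using aA assms(2) by blast+
    show "m' (\<phi> a) (\<phi> a') \<in> commuting_part D' m'" "m' (\<phi> a') (\<phi> a) \<in> commuting_part D' m'"
      using Z[of "m a a'"] Z[of "m a' a"] assms(3)[OF aA] assms(3)[OF aA(2,1)] a
      unfolding dual_pair_def by simp_all
    show "m' (m' (\<phi> a) (\<phi> a')) (\<phi> a) = \<phi> a" using eq[OF aA] a unfolding dual_pair_def by blast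
    show "m' (m' (\<phi> a') (\<phi> a)) (\<phi> a') = \<phi> a'" using eq[OF aA(2,1)] a unfolding dual_pair_def by blast
    fix d assume "d \<in> D'"
    then show "m' (m' (\<phi> a) d) (\<phi> a') \<in> D'" "m' (m' (\<phi> a') d) (\<phi> a) \<in> D'"
      using conj[OF aA _ \<open>d \<in> D'\<close>] conj[OF aA(2,1) _ \<open>d \<in> D'\<close>] a unfolding dual_pair_def by blast+
  qed
qed

locale diagonal_semigroup =
  fixes A D :: "'a set" and m :: "'a \<Rightarrow> 'a \<Rightarrow> 'a" (infixl "\<cdot>" 70)
  assumes closed [simp]: "a \<in> A \<Longrightarrow> b \<in> A \<Longrightarrow> a \<cdot> b \<in> A"
    and assoc: "a \<in> A \<Longrightarrow> b \<in> A \<Longrightarrow> c \<in> A \<Longrightarrow> a \<cdot> b \<cdot> c = a \<cdot> (b \<cdot> c)"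
    and D_subset: "D \<subseteq> A"
begin

abbreviation Z where "Z \<equiv> commuting_part D m"
abbreviation dual where "dual \<equiv> dual_pair A D m"

lemma D_closed [simp]: "d \<in> D \<Longrightarrow> d \<in> A"
  using D_subset by blast

lemma Z_subset: "z \<in> Z \<Longrightarrow> z \<in> D"
  by (simp add: commuting_part_def)

lemma Z_commute: "z \<in> Z \<Longrightarrow> d \<in> D \<Longrightarrow> z \<cdot> d = d \<cdot> z"
  by (simp add: commuting_part_def)

lemma dualD:
  assumes "dual a a'"
  shows "a \<in> A" "a' \<in> A" "a \<cdot> a' \<in> Z" "a' \<cdot> a \<in> Z" "a \<cdot> (a' \<cdot> a) = a" "a' \<cdot> (a \<cdot> a') = a'"
    "a \<cdot> a' \<cdot> a = a" "a' \<cdot> a \<cdot> a' = a'"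
    "d \<in> D \<Longrightarrow> a \<cdot> d \<cdot> a' \<in> D" "d \<in> D \<Longrightarrow> a' \<cdot> d \<cdot> a \<in> D"
  using assms assoc[of a a' a] assoc[of a' a a'] unfolding dual_pair_def by metis+

lemma dual_idempotent: "dual a a' \<Longrightarrow> (a \<cdot> a') \<cdot> (a \<cdot> a') = a \<cdot> a'"
  using assoc[of "a \<cdot> a'" a a'] dualD[of a a'] by simp

text \<open>The map \<open>e \<mapsto> aea'\<close> sends central idempotents of \<open>D\<close> to central idempotents of \<open>D\<close>. It is the
  action of \<open>a\<close> on the compact open sets of units: restricting \<open>a\<close> to the sources in \<open>e\<close> is the same
  as restricting it to the ranges in \<open>aea'\<close>. Centrality holds because \<open>d \<mapsto> a'da\<close> maps \<open>D\<close> to \<open>D\<close> and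
  \<open>e\<close> commutes with \<open>a'da\<close>.\<close>

lemma dual_moves_idempotent:
  assumes a: "dual a a'" and e: "e \<in> Z" "e \<cdot> e = e"
  shows "a \<cdot> e \<cdot> a' \<in> Z" "a \<cdot> e \<cdot> a' \<cdot> (a \<cdot> e \<cdot> a') = a \<cdot> e \<cdot> a'"
    "a \<cdot> e = a \<cdot> e \<cdot> a' \<cdot> a" "e \<cdot> a' = a' \<cdot> (a \<cdot> e \<cdot> a')"
proof -
  note aD = dualD[OF a]
  note A = aD(1,2)
  have eD: "e \<in> D" "e \<in> A" using e(1) Z_subset D_closed by blast+
  have a'a: "a' \<cdot> a \<in> D" "a \<cdot> a' \<in> D" using aD(3,4) Z_subset by blast+
  let ?f = "a \<cdot> e \<cdot> a'"
  have fD: "?f \<in> D" using aD(9)[OF eD(1)] .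
  have "?f \<cdot> a = a \<cdot> (e \<cdot> (a' \<cdot> a))" using A eD by (simp add: assoc)
  also have "\<dots> = a \<cdot> (a' \<cdot> a \<cdot> e)" using Z_commute[OF e(1) a'a(1)] by simp
  also have "\<dots> = a \<cdot> (a' \<cdot> a) \<cdot> e" using A eD by (simp add: assoc)
  finally show 1: "a \<cdot> e = ?f \<cdot> a" using aD(5) by simp
  have "a' \<cdot> ?f = a' \<cdot> a \<cdot> e \<cdot> a'" using A eD by (simp add: assoc)
  also have "\<dots> = e \<cdot> (a' \<cdot> a) \<cdot> a'" using Z_commute[OF e(1) a'a(1)] by simp
  also have "\<dots> = e \<cdot> (a' \<cdot> a \<cdot> a')" using A eD by (simp add: assoc)
  finally show 2: "e \<cdot> a' = a' \<cdot> ?f" using aD(8) by simp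
  have "?f \<cdot> ?f = a \<cdot> e \<cdot> (a' \<cdot> ?f)" using A eD by (simp add: assoc)
  also have "\<dots> = a \<cdot> (e \<cdot> e) \<cdot> a'" unfolding 2[symmetric] using A eD by (simp add: assoc)
  finally show "?f \<cdot> ?f = ?f" using e(2) by simp
  have "?f \<cdot> d = d \<cdot> ?f" if d: "d \<in> D" for d
  proof -
    have dA: "d \<in> A" using d by simp
    let ?g = "a' \<cdot> d \<cdot> a"
    have g: "?g \<in> D" "?g \<in> A" using aD(10)[OF d] D_closed by blast+
    have "a' \<cdot> d = a' \<cdot> (a \<cdot> a' \<cdot> d)" using aD(6) A dA by (metis assoc closed)
    also have "\<dots> = a' \<cdot> (d \<cdot> (a \<cdot> a'))" using Z_commute[OF aD(3) d] by simp
    also have "\<dots> = ?g \<cdot> a'" using A dA by (simp add: assoc)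
    finally have left: "a' \<cdot> d = ?g \<cdot> a'" .
    have "d \<cdot> a = d \<cdot> (a \<cdot> a') \<cdot> a" using aD(7) A dA by (metis assoc closed)
    also have "\<dots> = a \<cdot> a' \<cdot> d \<cdot> a" using Z_commute[OF aD(3) d] by simp
    also have "\<dots> = a \<cdot> ?g" using A dA by (simp add: assoc)
    finally have right: "d \<cdot> a = a \<cdot> ?g" .
    have "?f \<cdot> d = a \<cdot> e \<cdot> (a' \<cdot> d)" using A dA eD by (simp add: assoc)
    also have "\<dots> = a \<cdot> (e \<cdot> ?g) \<cdot> a'" by (subst left) (use A dA eD in \<open>simp add: assoc\<close>)
    also have "\<dots> = a \<cdot> (?g \<cdot> e) \<cdot> a'" using Z_commute[OF e(1) g(1)] by simp
    also have "\<dots> = a \<cdot> ?g \<cdot> (e \<cdot> a')" using A dA eD by (simp add: assoc)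
    also have "\<dots> = d \<cdot> ?f" unfolding right[symmetric] using A dA eD by (simp add: assoc)
    finally show ?thesis .
  qed
  then show "?f \<in> Z" using fD unfolding commuting_part_def by blast
qed

lemma dual_mul:
  assumes a: "dual a a'" and b: "dual b b'"
  shows "dual (a \<cdot> b) (b' \<cdot> a')"
proof -
  note aD = dualD[OF a] and bD = dualD[OF b]
  note A = aD(1,2) bD(1,2)
  have Za: "a' \<cdot> a \<in> Z" "a' \<cdot> a \<in> D" and Zb: "b \<cdot> b' \<in> Z" "b \<cdot> b' \<in> D"
    using aD(4) bD(3) Z_subset by blast+
  have idem: "b \<cdot> b' \<cdot> (b \<cdot> b') = b \<cdot> b'" "a' \<cdot> a \<cdot> (a' \<cdot> a) = a' \<cdot> a"
    using dual_idempotent[OF b] dual_idempotent[OF dual_pair_sym[OF a]] by simp_all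
  have 1: "a \<cdot> b \<cdot> (b' \<cdot> a') = a \<cdot> (b \<cdot> b') \<cdot> a'" and 2: "b' \<cdot> a' \<cdot> (a \<cdot> b) = b' \<cdot> (a' \<cdot> a) \<cdot> b"
    using A by (simp_all add: assoc)
  have "a \<cdot> b \<cdot> (b' \<cdot> a') \<cdot> (a \<cdot> b) = a \<cdot> ((b \<cdot> b') \<cdot> (a' \<cdot> a)) \<cdot> b" using A by (simp add: assoc)
  also have "\<dots> = a \<cdot> ((a' \<cdot> a) \<cdot> (b \<cdot> b')) \<cdot> b" using Z_commute[OF Zb(1) Za(2)] by simp
  also have "\<dots> = (a \<cdot> a' \<cdot> a) \<cdot> (b \<cdot> b' \<cdot> b)" using A by (simp add: assoc)
  finally have 3: "a \<cdot> b \<cdot> (b' \<cdot> a') \<cdot> (a \<cdot> b) = a \<cdot> b" using aD(7) bD(7) by simp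
  have "b' \<cdot> a' \<cdot> (a \<cdot> b) \<cdot> (b' \<cdot> a') = b' \<cdot> ((a' \<cdot> a) \<cdot> (b \<cdot> b')) \<cdot> a'" using A by (simp add: assoc)
  also have "\<dots> = b' \<cdot> ((b \<cdot> b') \<cdot> (a' \<cdot> a)) \<cdot> a'" using Z_commute[OF Zb(1) Za(2)] by simp
  also have "\<dots> = (b' \<cdot> b \<cdot> b') \<cdot> (a' \<cdot> a \<cdot> a')" using A by (simp add: assoc)
  finally have 4: "b' \<cdot> a' \<cdot> (a \<cdot> b) \<cdot> (b' \<cdot> a') = b' \<cdot> a'" using aD(8) bD(8) by simp
  have 5: "a \<cdot> b \<cdot> d \<cdot> (b' \<cdot> a') \<in> D" "b' \<cdot> a' \<cdot> d \<cdot> (a \<cdot> b) \<in> D" if "d \<in> D" for d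
  proof -
    have "a \<cdot> b \<cdot> d \<cdot> (b' \<cdot> a') = a \<cdot> (b \<cdot> d \<cdot> b') \<cdot> a'" using A that by (simp add: assoc)
    then show "a \<cdot> b \<cdot> d \<cdot> (b' \<cdot> a') \<in> D" using aD(9)[OF bD(9)[OF that]] by simp
    have "b' \<cdot> a' \<cdot> d \<cdot> (a \<cdot> b) = b' \<cdot> (a' \<cdot> d \<cdot> a) \<cdot> b" using A that by (simp add: assoc)
    then show "b' \<cdot> a' \<cdot> d \<cdot> (a \<cdot> b) \<in> D" using bD(10)[OF aD(10)[OF that]] by simp
  qed
  show ?thesis
    unfolding dual_pair_def
  proof (intro conjI ballI)
    show "a \<cdot> b \<cdot> (b' \<cdot> a') \<in> Z" unfolding 1 by (rule dual_moves_idempotent(1)[OF a Zb(1) idem(1)])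
    show "b' \<cdot> a' \<cdot> (a \<cdot> b) \<in> Z"
      unfolding 2 by (rule dual_moves_idempotent(1)[OF dual_pair_sym[OF b] Za(1) idem(2)])
  qed (use A 3 4 5 in simp_all)
qed

end

section \<open>Semigroups of partial functions\<close>

lemma option_eqI: "(\<And>z. x = Some z \<longleftrightarrow> y = Some z) \<Longrightarrow> x = y"
  by (cases x; cases y) auto

definition char_fun :: "'y \<Rightarrow> 'g set \<Rightarrow> ('g \<rightharpoonup> 'y)" where
  "char_fun e K = (\<lambda>g. if g \<in> K then Some e else None)"

lemma char_fun_Some [simp]: "char_fun e K g = Some x \<longleftrightarrow> g \<in> K \<and> x = e"
  and dom_char_fun [simp]: "dom (char_fun e K) = K"
  by (auto simp: char_fun_def dom_def)

locale function_system = ample_groupoid G for G :: "'g top_groupoid" +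
  fixes Y :: "'y semigroupoid" and A :: "('g \<rightharpoonup> 'y) set"
    and m :: "('g \<rightharpoonup> 'y) \<Rightarrow> ('g \<rightharpoonup> 'y) \<Rightarrow> ('g \<rightharpoonup> 'y)" (infixl "\<cdot>" 70)
  assumes indecomposable: "indecomposable Y"
    and function_semigroup: "function_semigroup G Y A m"
    and exhaustive: "exhaustive G Y (subD G A)"
    and compact_bumpy: "compact_bumpy G Y (subS G A)"
    and CRZ_subset: "subCRZ G Y A m \<subseteq> subS G A"
begin

abbreviation D where "D \<equiv> subD G A"
abbreviation one where "one \<equiv> one_of Y"
abbreviation chi where "chi \<equiv> char_fun one"

lemma one: "one \<in> elems Y" "y \<in> elems Y \<Longrightarrow> mul Y one y = Some y" "y \<in> elems Y \<Longrightarrow> mul Y y one = Some y"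
proof -
  have "unit_elem Y one" using indecomposable one_of_eq unfolding indecomposable_def by metis
  then show "one \<in> elems Y" "y \<in> elems Y \<Longrightarrow> mul Y one y = Some y" "y \<in> elems Y \<Longrightarrow> mul Y y one = Some y"
    unfolding unit_elem_def by blast+
qed

lemma one_mul_one [simp]: "mul Y one one = Some one"
  using one by blast

lemma one_centre: "one \<in> centre_of Y"
  using one unfolding centre_of_def by simp

lemma central_idempotent: "z \<in> centre_of Y \<Longrightarrow> mul Y z z = Some z \<Longrightarrow> z = one"
  using indecomposable unfolding indecomposable_def by blast

lemma Y_assoc:
  assumes "x \<in> elems Y" "y \<in> elems Y" "z \<in> elems Y"
  shows "Option.bind (mul Y y z) (\<lambda>u. mul Y x u) = Option.bind (mul Y x y) (\<lambda>v. mul Y v z)"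
  using indecomposable assms unfolding indecomposable_def semigroupoid_def by blast

text \<open>Associativity is an equivalence of definedness: \<open>y = y(uv)\<close> is defined, therefore so is \<open>yu\<close>.\<close>

lemma mul_inverse_defined:
  assumes "inverse_of Y u v" "y \<in> elems Y"
  shows "\<exists>z. mul Y y u = Some z" "\<exists>z. mul Y u y = Some z"
proof -
  have uv: "u \<in> elems Y" "v \<in> elems Y" "mul Y u v = Some one" "mul Y v u = Some one"
    using assms(1) unfolding inverse_of_def by blast+
  show "\<exists>z. mul Y y u = Some z"
    using Y_assoc[OF assms(2) uv(1,2)] uv(3) one(3)[OF assms(2)] by (cases "mul Y y u") auto
  show "\<exists>z. mul Y u y = Some z"
    using Y_assoc[OF uv(2,1) assms(2)] uv(4) one(2)[OF assms(2)] by (cases "mul Y u y") auto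
qed

lemma A_closed: "a \<in> A \<Longrightarrow> b \<in> A \<Longrightarrow> a \<cdot> b \<in> A"
  and A_assoc: "a \<in> A \<Longrightarrow> b \<in> A \<Longrightarrow> c \<in> A \<Longrightarrow> a \<cdot> b \<cdot> c = a \<cdot> (b \<cdot> c)"
  using function_semigroup unfolding function_semigroup_def by blast+

sublocale diagonal_semigroup A D m
  using A_closed A_assoc by unfold_locales (auto simp: subD_def)

lemma A_open: "a \<in> A \<Longrightarrow> openin (gtop G) (dom a)"
  using function_semigroup unfolding function_semigroup_def partial_funs_def by blast

lemma A_elems: "a \<in> A \<Longrightarrow> a g = Some x \<Longrightarrow> g \<in> elems G"
  using open_subset[OF A_open] by blast

lemma A_values: "a \<in> A \<Longrightarrow> a g = Some x \<Longrightarrow> x \<in> elems Y"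
  using function_semigroup unfolding function_semigroup_def partial_funs_def by (blast intro: ranI)

lemma mul_Some_iff:
  assumes "a \<in> A" "b \<in> A" "bisection G (dom a) \<or> bisection G (dom b)"
  shows "(a \<cdot> b) k = Some z \<longleftrightarrow>
    (\<exists>g h x y. mul G g h = Some k \<and> a g = Some x \<and> b h = Some y \<and> mul Y x y = Some z)"
  using function_semigroup assms unfolding function_semigroup_def by blast

lemma D_dom: "d \<in> D \<Longrightarrow> dom d \<subseteq> gunits G"
  unfolding subD_def by blast

lemma D_units: "d \<in> D \<Longrightarrow> d g = Some x \<Longrightarrow> g \<in> gunits G"
  by (rule subsetD[OF D_dom domI])

lemma D_bisection: "d \<in> D \<Longrightarrow> bisection G (dom d)"
  using bisection_units[OF D_dom] .

lemma D_mul_left: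
  assumes d: "d \<in> D" and a: "a \<in> A"
  shows "(d \<cdot> a) k = Some z \<longleftrightarrow> (\<exists>x y. d (r k) = Some x \<and> a k = Some y \<and> mul Y x y = Some z)"
proof -
  have "mul G g h = Some k \<longleftrightarrow> g = r k \<and> h = k" if "d g = Some x" "a h = Some y" for g h x y
    using mul_unit_left[OF D_units[OF d that(1)] A_elems[OF a that(2)]] by metis
  then show ?thesis
    unfolding mul_Some_iff[OF D_closed[OF d] a disjI1[OF D_bisection[OF d]]]
    using A_elems[OF a] mul_r by blast
qed

lemma D_mul_right:
  assumes d: "d \<in> D" and a: "a \<in> A"
  shows "(a \<cdot> d) k = Some z \<longleftrightarrow> (\<exists>x y. a k = Some x \<and> d (s k) = Some y \<and> mul Y x y = Some z)"
proof -
  have "mul G g h = Some k \<longleftrightarrow> g = k \<and> h = s k" if "a g = Some x" "d h = Some y" for g h x y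
    using mul_unit_right[OF D_units[OF d that(2)] A_elems[OF a that(1)]] by metis
  then show ?thesis
    unfolding mul_Some_iff[OF a D_closed[OF d] disjI2[OF D_bisection[OF d]]]
    using A_elems[OF a] mul_s by blast
qed

text \<open>On the unit space the product is pointwise.\<close>

lemma D_mul_D:
  assumes d: "d \<in> D" and e: "e \<in> D"
  shows "(d \<cdot> e) k = Some z \<longleftrightarrow> (\<exists>x y. d k = Some x \<and> e k = Some y \<and> mul Y x y = Some z)"
  unfolding D_mul_left[OF d D_closed[OF e]] using D_units[OF e] gunits_r by metis

lemma D_mul_closed:
  assumes "d \<in> D" "e \<in> D"
  shows "d \<cdot> e \<in> D"
proof -
  have "dom (d \<cdot> e) \<subseteq> dom d" using D_mul_D[OF assms] by blast
  then show ?thesis using A_closed[of d e] assms D_dom[OF assms(1)] unfolding subD_def by blast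
qed

text \<open>The topologically defined \<open>Z\<close> is the centre of \<open>D\<close>: products of diagonal elements are pointwise,
  and by exhaustiveness a value \<open>z(k)\<close> of a central \<open>z\<close> is tested against every element of \<open>Y\<close>.\<close>

lemma subZ_eq: "subZ G Y A = Z"
proof (intro equalityI subsetI)
  fix z assume z: "z \<in> subZ G Y A"
  then have zc: "x \<in> centre_of Y" if "z k = Some x" for k x
    using that unfolding subZ_def by (blast intro: ranI)
  have zD: "z \<in> D" using z unfolding subZ_def subD_def by blast
  have "z \<cdot> d = d \<cdot> z" if d: "d \<in> D" for d
  proof (rule ext, rule option_eqI)
    fix k v
    have "mul Y x y = mul Y y x" if "z k = Some x" "d k = Some y" for x y
      using zc[OF that(1)] A_values[OF D_closed[OF d] that(2)] unfolding centre_of_def by simp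
    then show "(z \<cdot> d) k = Some v \<longleftrightarrow> (d \<cdot> z) k = Some v"
      unfolding D_mul_D[OF zD d] D_mul_D[OF d zD] by metis
  qed
  then show "z \<in> Z" using zD unfolding commuting_part_def by blast
next
  fix z assume z: "z \<in> Z"
  then have zD: "z \<in> D" by (rule Z_subset)
  have "x \<in> centre_of Y" if zk: "z k = Some x" for k x
  proof -
    have "mul Y y x = mul Y x y" if y: "y \<in> elems Y" for y
    proof -
      obtain d where d: "d \<in> D" "d k = Some y"
        using exhaustive D_units[OF zD zk] y unfolding exhaustive_def by blast
      have "(z \<cdot> d) k = (d \<cdot> z) k" using Z_commute[OF z d(1)] by simp
      moreover have "(z \<cdot> d) k = Some v \<longleftrightarrow> mul Y x y = Some v" for v
        unfolding D_mul_D[OF zD d(1)] using zk d(2) by simp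
      moreover have "(d \<cdot> z) k = Some v \<longleftrightarrow> mul Y y x = Some v" for v
        unfolding D_mul_D[OF d(1) zD] using zk d(2) by simp
      ultimately show ?thesis by (metis option_eqI)
    qed
    then show ?thesis using A_values[OF D_closed[OF zD] zk] unfolding centre_of_def by blast
  qed
  then have "ran z \<subseteq> centre_of Y" by (auto simp: ran_def)
  then show "z \<in> subZ G Y A" using D_dom[OF zD] D_closed[OF zD] unfolding subZ_def by blast
qed

lemma chi_in_Z:
  assumes "chi K \<in> A" "K \<subseteq> gunits G"
  shows "chi K \<in> Z"
  unfolding subZ_eq[symmetric] subZ_def using assms one_centre by (auto simp: ran_def)

lemma chi_mul_left:
  assumes "chi K \<in> D" "a \<in> A"
  shows "(chi K \<cdot> a) k = Some z \<longleftrightarrow> r k \<in> K \<and> a k = Some z"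
  unfolding D_mul_left[OF assms] using one(2)[OF A_values[OF assms(2)]] by force

lemma chi_mul_right:
  assumes "chi K \<in> D" "a \<in> A"
  shows "(a \<cdot> chi K) k = Some z \<longleftrightarrow> s k \<in> K \<and> a k = Some z"
  unfolding D_mul_right[OF assms] using one(3)[OF A_values[OF assms(2)]] by force

lemma chi_idempotent: "chi K \<in> D \<Longrightarrow> chi K \<cdot> chi K = chi K"
  by (rule ext, rule option_eqI) (auto simp: D_mul_D)

text \<open>Every value of \<open>e\<close> is a central idempotent of \<open>Y\<close>, hence \<open>1\<close> by indecomposability, and then
  1-properness makes the domain compact.\<close>

lemma central_idempotent_eq_chi:
  assumes e: "e \<in> Z" "e \<cdot> e = e"
  shows "e = chi (dom e)" "dom e \<in> cobs"
proof -
  have eD: "e \<in> D" using e(1) by (rule Z_subset)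
  have val: "x = one" if x: "e k = Some x" for k x
  proof (rule central_idempotent)
    show "x \<in> centre_of Y" using e(1) x unfolding subZ_eq[symmetric] subZ_def by (auto intro: ranI)
    have "(e \<cdot> e) k = Some x" using e(2) x by simp
    then show "mul Y x x = Some x" unfolding D_mul_D[OF eD eD] using x by simp
  qed
  show "e = chi (dom e)"
    by (rule ext, rule option_eqI) (use val in \<open>auto simp: dom_def\<close>)
  have "preim {one} e = dom e" using val by (auto simp: preim_def)
  moreover have "e \<in> subS G A" using D_bisection[OF eD] D_closed[OF eD] by (simp add: subS_def)
  ultimately have "compactin (gtop G) (dom e)" using compact_bumpy unfolding compact_bumpy_def by metis
  then show "dom e \<in> cobs" using cobsI D_bisection[OF eD] A_open[OF D_closed[OF eD]] by blast
qed

lemma dual_chi: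
  assumes "dual a a'"
  obtains K where "a \<cdot> a' = chi K" "K \<in> cobs" "chi K \<in> D" "K \<subseteq> gunits G"
proof -
  have Z: "a \<cdot> a' \<in> Z" using dualD(3)[OF assms] .
  note * = central_idempotent_eq_chi[OF Z dual_idempotent[OF assms]]
  show ?thesis
    using that[of "dom (a \<cdot> a')"] *(2) *(1)[symmetric] Z_subset[OF Z] D_dom[OF Z_subset[OF Z]] by simp
qed

text \<open>The domain of \<open>b\<close> may exceed the inverse of the domain of \<open>a\<close>, as it does in the conclusion of the
  compact involutivity axiom.\<close>

definition pointwise_inverse where
  "pointwise_inverse a b \<longleftrightarrow>
    (\<forall>g\<in>dom a. \<exists>x y. a g = Some x \<and> b (inv g) = Some y \<and> inverse_of Y x y)"

lemma exists_pointwise_inverse: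
  assumes K: "K \<in> cobs"
  shows "\<exists>a\<in>A. \<exists>b\<in>A. dom a = K \<and> bisection G (dom b) \<and> pointwise_inverse a b"
proof -
  have KK: "K \<in> compact_bisections G" "K \<in> open_bisections G" using K by (auto simp: cobs_def)
  then have "\<exists>a\<in>subS G A. dom a \<subseteq> K \<and> K \<subseteq> preim (invertibles Y) a"
    using compact_bumpy unfolding compact_bumpy_def by blast
  then obtain a where a: "a \<in> subS G A" "dom a \<subseteq> K" "K \<subseteq> preim (invertibles Y) a" by blast
  moreover have "\<forall>a\<in>subS G A. \<forall>K. K \<subseteq> preim (invertibles Y) a \<and> compactin (gtop G) K \<longrightarrow>
        (\<exists>b\<in>subS G A. \<forall>g\<in>K. \<exists>x y. a g = Some x \<and> b (inv g) = Some y \<and> inverse_of Y x y)"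
    using compact_bumpy unfolding compact_bumpy_def by (elim conjE)
  ultimately obtain b where b: "b \<in> subS G A"
    "\<forall>g\<in>K. \<exists>x y. a g = Some x \<and> b (inv g) = Some y \<and> inverse_of Y x y"
    using cobsD(3)[OF K] by blast
  have "dom a = K" using a(2,3) by (auto simp: preim_def)
  then show ?thesis using a(1) b unfolding subS_def pointwise_inverse_def by blast
qed

text \<open>The domain of \<open>b\<close> is a bisection that contains every \<open>g\<inverse>\<close> with \<open>g \<in> dom a\<close>, so \<open>g\<inverse>\<close> is the only
  element of it that can be multiplied with \<open>g\<close>. This makes the products constantly \<open>1\<close> whatever \<open>b\<close>
  is elsewhere.\<close>

lemma pointwise_inverse_mul:
  assumes a: "a \<in> A" "bisection G (dom a)" and b: "b \<in> A" "bisection G (dom b)"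
    and ab: "pointwise_inverse a b"
  shows "a \<cdot> b = chi (r ` dom a)" "b \<cdot> a = chi (s ` dom a)"
proof -
  have inv: "\<exists>x y. a g = Some x \<and> b (inv g) = Some y \<and> mul Y x y = Some one \<and> mul Y y x = Some one"
    if "g \<in> dom a" for g
    using ab that unfolding pointwise_inverse_def inverse_of_def by blast
  have inv_eq: "a g = Some x \<Longrightarrow> b (inv g) = Some y \<Longrightarrow> mul Y x y = Some one \<and> mul Y y x = Some one"
    for g x y
    using inv[of g] by force
  have el: "g \<in> elems G" if "g \<in> dom a \<or> g \<in> dom b" for g
    using that A_elems[OF a(1)] A_elems[OF b(1)] by blast
  have invb: "inv g \<in> dom b" if "g \<in> dom a" for g using inv[OF that] by blast
  show "a \<cdot> b = chi (r ` dom a)"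
  proof (rule ext, rule option_eqI)
    fix k z
    have "k \<in> r ` dom a \<and> z = one" if "mul G g h = Some k" "a g = Some x" "b h = Some y" "mul Y x y = Some z"
      for g h x y
    proof -
      have g: "g \<in> dom a" "h \<in> dom b" using that by auto
      have "r h = r (inv g)" using mul_s_r(1)[OF that(1)] el g by simp
      then have "h = inv g" using bisection_r_inj[OF b(2) g(2) invb[OF g(1)]] by simp
      then show ?thesis using mul_inv_right[of g] el g inv_eq[OF that(2)] that by auto
    qed
    moreover have "\<exists>h x y. mul G g h = Some (r g) \<and> a g = Some x \<and> b h = Some y \<and> mul Y x y = Some one"
      if "g \<in> dom a" for g
      using inv[OF that] mul_inv_right[of g] el that by blast
    ultimately show "(a \<cdot> b) k = Some z \<longleftrightarrow> chi (r ` dom a) k = Some z"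
      unfolding mul_Some_iff[OF a(1) b(1) disjI1[OF a(2)]] char_fun_Some by blast
  qed
  show "b \<cdot> a = chi (s ` dom a)"
  proof (rule ext, rule option_eqI)
    fix k z
    have "k \<in> s ` dom a \<and> z = one" if "mul G h g = Some k" "b h = Some y" "a g = Some x" "mul Y y x = Some z"
      for g h x y
    proof -
      have g: "g \<in> dom a" "h \<in> dom b" using that by auto
      have "s h = s (inv g)" using mul_s_r(1)[OF that(1)] el g by simp
      then have "h = inv g" using bisection_s_inj[OF b(2) g(2) invb[OF g(1)]] by simp
      then show ?thesis using mul_inv_left[of g] el g inv_eq[OF that(3)] that by auto
    qed
    moreover have "\<exists>h x y. mul G h g = Some (s g) \<and> b h = Some y \<and> a g = Some x \<and> mul Y y x = Some one"
      if "g \<in> dom a" for g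
      using inv[OF that] mul_inv_left[of g] el that by blast
    ultimately show "(b \<cdot> a) k = Some z \<longleftrightarrow> chi (s ` dom a) k = Some z"
      unfolding mul_Some_iff[OF b(1) a(1) disjI2[OF a(2)]] char_fun_Some by blast
  qed
qed

text \<open>The bumpiness axioms supply \<open>a\<close> and \<open>b\<close> such that \<open>b\<close> inverts \<open>a\<close> pointwise, but the domain of
  \<open>b\<close> may be too large; \<open>bab\<close> is the restriction of \<open>b\<close> to \<open>K\<inverse>\<close>.\<close>

lemma exists_dual:
  assumes K: "K \<in> cobs"
  shows "\<exists>a a'. dual a a' \<and> dom a = K \<and> dom a' = set_inv G K \<and> pointwise_inverse a a'"
proof -
  obtain a b where a: "a \<in> A" "dom a = K" and b: "b \<in> A" "bisection G (dom b)" and ab: "pointwise_inverse a b"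
    using exists_pointwise_inverse[OF K] by blast
  have bis: "bisection G (dom a)" using cobsD(1)[OF K] a(2) by simp
  note el = A_elems[OF a(1)] A_elems[OF b(1)]
  note prod = pointwise_inverse_mul[OF a(1) bis b ab]
  have sub: "r ` dom a \<subseteq> gunits G" "s ` dom a \<subseteq> gunits G" using el(1) r_gunits s_gunits by blast+
  have abZ: "a \<cdot> b \<in> Z" "b \<cdot> a \<in> Z"
    using chi_in_Z[OF _ sub(1)] chi_in_Z[OF _ sub(2)] prod A_closed[OF a(1) b(1)] A_closed[OF b(1) a(1)]
    by simp_all
  then have abD: "a \<cdot> b \<in> D" "b \<cdot> a \<in> D" using Z_subset by blast+
  have invb: "inv g \<in> dom b" if "g \<in> dom a" for g
    using ab that unfolding pointwise_inverse_def by blast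
  have aba: "a \<cdot> (b \<cdot> a) = a"
  proof (rule ext, rule option_eqI)
    fix k z
    show "(a \<cdot> (b \<cdot> a)) k = Some z \<longleftrightarrow> a k = Some z"
      unfolding prod(2) chi_mul_right[OF abD(2)[unfolded prod(2)] a(1)] by auto
  qed
  let ?a' = "b \<cdot> a \<cdot> b"
  have A: "a \<in> A" "b \<in> A" "?a' \<in> A" using a b by simp_all
  have aba': "a \<cdot> b \<cdot> a = a" using aba A by (simp add: assoc)
  have aa': "a \<cdot> ?a' = a \<cdot> b"
  proof -
    have "a \<cdot> ?a' = a \<cdot> b \<cdot> a \<cdot> b" using A by (simp add: assoc)
    then show ?thesis using aba' by simp
  qed
  have a'a: "?a' \<cdot> a = b \<cdot> a"
  proof -
    have "?a' \<cdot> a = b \<cdot> (a \<cdot> b \<cdot> a)" using A by (simp add: assoc)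
    then show ?thesis using aba' by simp
  qed
  have a'_val: "?a' k = Some z \<longleftrightarrow> s (inv k) \<in> s ` dom a \<and> b k = Some z" for k z
  proof -
    have "?a' k = Some z \<longleftrightarrow> r k \<in> s ` dom a \<and> b k = Some z"
      unfolding prod(2) by (rule chi_mul_left[OF abD(2)[unfolded prod(2)] b(1)])
    then show ?thesis using el(2)[of k z] by auto
  qed
  have units: "k \<in> gunits G" if g: "g \<in> dom a" and h: "h \<in> dom b" and k: "mul G g h = Some k \<or> mul G h g = Some k"
    for g h k
  proof -
    have el: "g \<in> elems G" "h \<in> elems G" using g h el by blast+
    have "h = inv g"
      using k
    proof
      assume "mul G g h = Some k"
      then have "r h = r (inv g)" using mul_s_r(1)[of g h k] el by simp
      then show ?thesis using bisection_r_inj[OF b(2) h invb[OF g]] by simp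
    next
      assume "mul G h g = Some k"
      then have "s h = s (inv g)" using mul_s_r(1)[of h g k] el by simp
      then show ?thesis using bisection_s_inj[OF b(2) h invb[OF g]] by simp
    qed
    then show ?thesis using k mul_inv_left[OF el(1)] mul_inv_right[OF el(1)] s_gunits r_gunits el by auto
  qed
  have adb: "a \<cdot> d \<cdot> b \<in> D" "b \<cdot> d \<cdot> a \<in> D" if d: "d \<in> D" for d
  proof -
    have dA: "d \<in> A" using d by simp
    have 1: "dom (a \<cdot> d) \<subseteq> dom a" "dom (d \<cdot> a) \<subseteq> dom a"
      using D_mul_right[OF d a(1)] D_mul_left[OF d a(1)] by blast+
    have "k \<in> gunits G" if "(a \<cdot> d \<cdot> b) k = Some z" for k z
      using that mul_Some_iff[of "a \<cdot> d" b k z] units 1(1) b A dA by (simp add: subset_iff) blast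
    moreover have "k \<in> gunits G" if "(b \<cdot> (d \<cdot> a)) k = Some z" for k z
      using that mul_Some_iff[of b "d \<cdot> a" k z] units 1(2) b A dA by (simp add: subset_iff) blast
    ultimately show "a \<cdot> d \<cdot> b \<in> D" "b \<cdot> d \<cdot> a \<in> D"
      unfolding subD_def using A dA assoc[of b d a] closed by auto
  qed
  have "dual a ?a'"
    unfolding dual_pair_def
  proof (intro conjI ballI)
    show "a \<in> A" "?a' \<in> A" by fact+
    show "a \<cdot> ?a' \<in> Z" "?a' \<cdot> a \<in> Z" unfolding aa' a'a by fact+
    show "a \<cdot> ?a' \<cdot> a = a" unfolding aa' by fact
    show "?a' \<cdot> a \<cdot> ?a' = ?a'" unfolding a'a using A aa' by (simp add: assoc)
    fix d assume d: "d \<in> D"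
    have "a \<cdot> d \<cdot> ?a' = (a \<cdot> d \<cdot> b) \<cdot> (a \<cdot> b)" using A d by (simp add: assoc)
    then show "a \<cdot> d \<cdot> ?a' \<in> D" using D_mul_closed[OF adb(1)[OF d] abD(1)] by simp
    have "?a' \<cdot> d \<cdot> a = (b \<cdot> a) \<cdot> (b \<cdot> d \<cdot> a)" using A d by (simp add: assoc)
    then show "?a' \<cdot> d \<cdot> a \<in> D" using D_mul_closed[OF abD(2) adb(2)[OF d]] by simp
  qed
  moreover have "pointwise_inverse a ?a'"
    unfolding pointwise_inverse_def
  proof
    fix g assume g: "g \<in> dom a"
    obtain x y where xy: "a g = Some x" "b (inv g) = Some y" "inverse_of Y x y"
      using ab g unfolding pointwise_inverse_def by blast
    then have "?a' (inv g) = Some y" using a'_val[of "inv g" y] g el(1)[OF xy(1)] by simp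
    then show "\<exists>x y. a g = Some x \<and> ?a' (inv g) = Some y \<and> inverse_of Y x y" using xy by blast
  qed
  moreover have "dom ?a' = set_inv G K"
  proof (intro equalityI subsetI)
    fix k assume "k \<in> dom ?a'"
    then obtain z where "?a' k = Some z" by blast
    then obtain g where g: "g \<in> dom a" "s (inv k) = s g" "k \<in> dom b" using a'_val[of k z] by blast
    then have "g \<in> elems G" "k \<in> elems G" using el by blast+
    then have "r k = r (inv g)" using g(2) by simp
    then have "k = inv g" using bisection_r_inj[OF b(2) g(3) invb[OF g(1)]] by simp
    then show "k \<in> set_inv G K" using g(1) a(2) by (simp add: set_inv_def)
  next
    fix k assume "k \<in> set_inv G K"
    then obtain g where g: "g \<in> dom a" "k = inv g" using a(2) by (auto simp: set_inv_def)
    then show "k \<in> dom ?a'" using \<open>pointwise_inverse a ?a'\<close> unfolding pointwise_inverse_def by blast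
  qed
  ultimately show ?thesis using a(2) by blast
qed

lemma chi_cobs:
  assumes "K \<in> cobs" "K \<subseteq> gunits G"
  shows "chi K \<in> Z" "chi K \<in> D"
proof -
  obtain a b where a: "a \<in> A" "dom a = K" and b: "b \<in> A" "bisection G (dom b)" and ab: "pointwise_inverse a b"
    using exists_pointwise_inverse[OF assms(1)] by blast
  have "s ` dom a = K" using a(2) assms(2) gunits_s by force
  then have "chi K \<in> A"
    using pointwise_inverse_mul(2)[OF a(1) _ b ab] cobsD(1)[OF assms(1)] a b by (metis A_closed)
  then show "chi K \<in> Z" using chi_in_Z assms(2) by blast
  then show "chi K \<in> D" by (rule Z_subset)
qed

end

section \<open>Dual pairs of functions\<close>

context function_system
begin

text \<open>The set \<open>L\<close> is the support of the idempotent \<open>aea'\<close> for the characteristic function \<open>e\<close> of \<open>K\<close>.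
  Membership of the source of \<open>g\<close> in a compact open set \<open>K\<close> thus only depends on the range of \<open>g\<close>.
  Since compact open sets separate units, the next three lemmas follow.\<close>

lemma dual_separates:
  assumes a: "dual a a'" and K: "K \<in> cobs" "K \<subseteq> gunits G"
  obtains L where "\<And>g. g \<in> dom a \<Longrightarrow> s g \<in> K \<longleftrightarrow> r g \<in> L" "\<And>g. g \<in> dom a' \<Longrightarrow> r g \<in> K \<longleftrightarrow> s g \<in> L"
proof -
  note chi = chi_cobs[OF K]
  note move = dual_moves_idempotent[OF a chi(1) chi_idempotent[OF chi(2)]]
  note aA = dualD(1,2)[OF a]
  let ?f = "a \<cdot> chi K \<cdot> a'"
  define L where "L = dom ?f"
  have f: "?f = chi L" using central_idempotent_eq_chi(1)[OF move(1,2)] unfolding L_def .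
  have fD: "chi L \<in> D" using Z_subset[OF move(1)] unfolding f .
  have "s g \<in> K \<longleftrightarrow> r g \<in> L" if g: "g \<in> dom a" for g
  proof -
    obtain x where x: "a g = Some x" using g by blast
    have "(a \<cdot> chi K) g = (chi L \<cdot> a) g" using move(3) unfolding f by simp
    then have "(a \<cdot> chi K) g = Some x \<longleftrightarrow> (chi L \<cdot> a) g = Some x" by simp
    then show ?thesis unfolding chi_mul_left[OF fD aA(1)] chi_mul_right[OF chi(2) aA(1)] using x by simp
  qed
  moreover have "r g \<in> K \<longleftrightarrow> s g \<in> L" if g: "g \<in> dom a'" for g
  proof -
    obtain x where x: "a' g = Some x" using g by blast
    have "(chi K \<cdot> a') g = (a' \<cdot> chi L) g" using move(4) unfolding f by simp
    then have "(chi K \<cdot> a') g = Some x \<longleftrightarrow> (a' \<cdot> chi L) g = Some x" by simp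
    then show ?thesis unfolding chi_mul_right[OF fD aA(2)] chi_mul_left[OF chi(2) aA(2)] using x by simp
  qed
  ultimately show ?thesis by (rule that)
qed

lemma dual_range_eq:
  assumes a: "dual a a'" and g: "g \<in> dom a" and h: "h \<in> dom a" and sgh: "s g = s h"
  shows "r g = r h"
proof (rule ccontr)
  assume "r g \<noteq> r h"
  have aA: "a \<in> A" using dualD(1)[OF a] .
  have el: "g \<in> elems G" "h \<in> elems G" using A_elems[OF aA] g h by blast+
  obtain K where K: "K \<in> cobs" "K \<subseteq> gunits G" "r g \<in> K" "r h \<notin> K"
    using separate_units[OF r_gunits[OF el(1)] r_gunits[OF el(2)] \<open>r g \<noteq> r h\<close>] by blast
  obtain L where "\<And>g. g \<in> dom a \<Longrightarrow> r g \<in> K \<longleftrightarrow> s g \<in> L"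
    using dual_separates[OF dual_pair_sym[OF a] K(1,2)] by metis
  then show False using g h K(3,4) sgh by metis
qed

lemma dual_source_eq:
  assumes a: "dual a a'" and g: "g \<in> dom a" and h: "h \<in> dom a" and rgh: "r g = r h"
  shows "s g = s h"
proof (rule ccontr)
  assume "s g \<noteq> s h"
  have aA: "a \<in> A" using dualD(1)[OF a] .
  have el: "g \<in> elems G" "h \<in> elems G" using A_elems[OF aA] g h by blast+
  obtain K where K: "K \<in> cobs" "K \<subseteq> gunits G" "s g \<in> K" "s h \<notin> K"
    using separate_units[OF s_gunits[OF el(1)] s_gunits[OF el(2)] \<open>s g \<noteq> s h\<close>] by blast
  obtain L where "\<And>g. g \<in> dom a \<Longrightarrow> s g \<in> K \<longleftrightarrow> r g \<in> L"
    using dual_separates[OF a K(1,2)] by metis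
  then show False using g h K(3,4) rgh by metis
qed

lemma dual_composable:
  assumes a: "dual a a'" and g: "g \<in> dom a" and h: "h \<in> dom a'" and gh: "s g = r h"
  shows "r g = s h"
proof (rule ccontr)
  assume "r g \<noteq> s h"
  have aA: "a \<in> A" "a' \<in> A" using dualD(1,2)[OF a] .
  have el: "g \<in> elems G" "h \<in> elems G" using A_elems[OF aA(1)] A_elems[OF aA(2)] g h by blast+
  obtain K where K: "K \<in> cobs" "K \<subseteq> gunits G" "r g \<in> K" "s h \<notin> K"
    using separate_units[OF r_gunits[OF el(1)] s_gunits[OF el(2)] \<open>r g \<noteq> s h\<close>] by blast
  obtain L where "\<And>g. g \<in> dom a' \<Longrightarrow> s g \<in> K \<longleftrightarrow> r g \<in> L" "\<And>g. g \<in> dom a \<Longrightarrow> r g \<in> K \<longleftrightarrow> s g \<in> L"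
    using dual_separates[OF dual_pair_sym[OF a] K(1,2)] by metis
  then show False using g h K(3,4) gh by metis
qed

text \<open>Fix \<open>g \<in> dom a\<close> and a small compact open bisection \<open>U\<close> with \<open>g \<in> U \<subseteq> dom a\<close>, and let \<open>t\<close>, \<open>t'\<close> be a
  dual pair supported on \<open>U\<inverse>\<close> and \<open>U\<close>. On \<open>U\<close> the elements of \<open>dom a\<close> move units as \<open>U\<close> does, so \<open>at\<close>
  and its dual \<open>t'a'\<close> have domains inside the isotropy. Thus \<open>at\<close> belongs to \<open>subCRZ\<close>, and the
  assumption that such functions live on bisections applies to it. If now
  \<open>h \<in> dom a\<close> has the same source as \<open>g\<close>, then \<open>hg\<inverse>\<close> and \<open>gg\<inverse>\<close> are elements of the bisection
  \<open>dom (at)\<close> with the same range, so they are equal, and \<open>h = g\<close>.\<close>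

lemma dual_bisection:
  assumes a: "dual a a'"
  shows "bisection G (dom a)"
proof -
  note aA = dualD(1,2)[OF a]
  have el: "x \<in> elems G" if "x \<in> dom a \<or> x \<in> dom a'" for x
    using that A_elems[OF aA(1)] A_elems[OF aA(2)] by blast
  have s_inj: "h = g" if g: "g \<in> dom a" and h: "h \<in> dom a" and sgh: "s h = s g" for g h
  proof -
    obtain U where U: "set_inv G U \<in> cobs" "g \<in> U" "U \<subseteq> dom a" "U \<in> cobs"
      using cobs_nbhd[OF A_open[OF aA(1)] g] by blast
    note Uel = cobsD(4)[OF U(4)]
    obtain t t' where t: "dual t t'" "dom t = set_inv G U" "dom t' = set_inv G (set_inv G U)" "pointwise_inverse t t'"
      using exists_dual[OF U(1)] by blast
    note tA = dualD(1,2)[OF t(1)]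
    have domt': "dom t' = U"
      unfolding t(3) using mem_set_inv_iff[OF Uel] mem_set_inv_iff[OF cobsD(4)[OF U(1)]] Uel
      by (auto simp: subset_iff)
    have bis: "bisection G (dom t)" "bisection G (dom t')"
      using cobsD(1)[OF U(1)] cobsD(1)[OF U(4)] t(2) domt' by simp_all
    let ?c = "a \<cdot> t" and ?c' = "t' \<cdot> a'"
    have c: "dual ?c ?c'" using dual_mul[OF a t(1)] .
    note c_iff = mul_Some_iff[OF aA(1) tA(1) disjI2[OF bis(1)]]
    note c'_iff = mul_Some_iff[OF tA(2) aA(2) disjI1[OF bis(2)]]
    have "?c \<in> subC G A"
    proof -
      have "k \<in> isotropy G" if kz: "?c k = Some z" for k z
      proof -
        obtain x y v w where xy: "mul G x y = Some k" "a x = Some v" "t y = Some w"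
          using kz unfolding c_iff by blast
        then have "y \<in> set_inv G U" "x \<in> dom a" using t(2) by auto
        then obtain l where l: "l \<in> U" "y = inv l" by (auto simp: set_inv_def)
        have E: "x \<in> elems G" "l \<in> elems G" "y \<in> elems G" using el \<open>x \<in> dom a\<close> l U(3) Uel by auto
        note m = mul_s_r[OF xy(1) E(1,3)]
        have "s x = s l" using m(1) l(2) E(2) by simp
        then have "r x = r l" using dual_range_eq[OF a \<open>x \<in> dom a\<close>] l(1) U(3) by blast
        then have "s k = r k" using m l(2) E by simp
        then show ?thesis using mul_closed[OF xy(1) E(1,3)] unfolding isotropy_def by blast
      qed
      then show ?thesis using aA(1) tA(1) unfolding subC_def by auto
    qed
    moreover have "?c' \<in> subC G A"
    proof -
      have "k \<in> isotropy G" if kz: "?c' k = Some z" for k z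
      proof -
        obtain x y v w where xy: "mul G x y = Some k" "t' x = Some v" "a' y = Some w"
          using kz unfolding c'_iff by blast
        then have xy': "x \<in> dom a" "y \<in> dom a'" using domt' U(3) by auto
        then have E: "x \<in> elems G" "y \<in> elems G" using el by auto
        note m = mul_s_r[OF xy(1) E]
        have "r x = s y" using dual_composable[OF a xy' m(1)] .
        then have "s k = r k" using m by simp
        then show ?thesis using mul_closed[OF xy(1) E] unfolding isotropy_def by blast
      qed
      then show ?thesis using aA(2) tA(2) unfolding subC_def by auto
    qed
    ultimately have "?c \<in> subCRZ G Y A m"
      unfolding subCRZ_def subZ_eq using dualD(3,4,7,8)[OF c] by blast
    then have cbis: "bisection G (dom ?c)" using CRZ_subset unfolding subS_def by blast
    have E: "g \<in> elems G" "h \<in> elems G" using el g h by auto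
    have "inv g \<in> dom t" using t(2) U(2) by (auto simp: set_inv_def)
    then obtain w w' where w: "t (inv g) = Some w" "inverse_of Y w w'"
      using t(4) unfolding pointwise_inverse_def by blast
    have c_dom: "k \<in> dom ?c" if x: "x \<in> dom a" and k: "mul G x (inv g) = Some k" for x k
    proof -
      obtain v where v: "a x = Some v" using x by blast
      then obtain z where "mul Y v w = Some z" using mul_inverse_defined(1)[OF w(2)] A_values[OF aA(1)] by blast
      then have "?c k = Some z" unfolding c_iff using v w k by blast
      then show ?thesis by blast
    qed
    obtain k where k: "mul G h (inv g) = Some k" using mul_defined_iff[of h "inv g"] E sgh by auto
    have "r k = r g"
      using mul_s_r(2)[OF k E(2) inv_closed[OF E(1)]] dual_range_eq[OF a h g sgh] by simp
    then have "r k = r (r g)" using E by simp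
    then have "k = r g"
      using bisection_r_inj[OF cbis c_dom[OF h k] c_dom[OF g mul_inv_right[OF E(1)]]] by blast
    then show "h = g" using eq_if_mul_inv_unit[OF k _ E(2,1)] r_gunits[OF E(1)] by blast
  qed
  have r_inj: "h = g" if "g \<in> dom a" "h \<in> dom a" "r h = r g" for g h
    using s_inj[OF that(1,2) dual_source_eq[OF a that(2,1,3)]] .
  have "inj_on s (dom a)" using s_inj by (intro inj_onI)
  moreover have "inj_on r (dom a)" using r_inj by (intro inj_onI)
  ultimately show ?thesis unfolding bisection_iff using el by blast
qed

text \<open>Now that the domain of \<open>a\<close> is a bisection, \<open>aa'\<close> and \<open>a'a\<close> can be computed pointwise. They are
  characteristic functions, so \<open>a'(g\<inverse>)\<close> is a right and a left inverse of \<open>a(g)\<close>.\<close>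

lemma dual_values:
  assumes a: "dual a a'" and g: "g \<in> dom a"
  shows "\<exists>x y. a g = Some x \<and> a' (inv g) = Some y \<and> inverse_of Y x y"
    and "s g \<in> dom (a' \<cdot> a)"
proof -
  note aA = dualD(1,2)[OF a]
  note bis = dual_bisection[OF a]
  have el: "x \<in> elems G" if "x \<in> dom a \<or> x \<in> dom a'" for x
    using that A_elems[OF aA(1)] A_elems[OF aA(2)] by blast
  have E: "g \<in> elems G" using el g by blast
  obtain x where x: "a g = Some x" using g by blast
  obtain K where K: "a \<cdot> a' = chi K" "chi K \<in> D" using dual_chi[OF a] by metis
  obtain L where L: "a' \<cdot> a = chi L" "chi L \<in> D" using dual_chi[OF dual_pair_sym[OF a]] by metis
  have "(chi K \<cdot> a) g = Some x" using dualD(7)[OF a] x K(1) by simp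
  then have "r g \<in> K" unfolding chi_mul_left[OF K(2) aA(1)] by blast
  then have "(a \<cdot> a') (r g) = Some one" unfolding K(1) by simp
  then obtain h k v y where hk: "mul G h k = Some (r g)" "a h = Some v" "a' k = Some y" "mul Y v y = Some one"
    unfolding mul_Some_iff[OF aA disjI1[OF bis]] by blast
  have hk': "h \<in> dom a" "k \<in> dom a'" using hk by auto
  then have hkE: "h \<in> elems G" "k \<in> elems G" using el by blast+
  have "r h = r g" using mul_s_r(2)[OF hk(1) hkE] E by simp
  then have "h = g" using bisection_r_inj[OF bis hk'(1) g] by simp
  have "mul G (inv g) (r g) = Some k" using mul_cancel_left[OF hk(1) hkE] \<open>h = g\<close> by simp
  then have k: "k = inv g" using mul_unit_right[OF r_gunits[OF E] inv_closed[OF E]] by simp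
  have "(a \<cdot> chi L) g = Some x" using dualD(5)[OF a] x L(1) by simp
  then have sL: "s g \<in> L" unfolding chi_mul_right[OF L(2) aA(1)] by blast
  then have "(a' \<cdot> a) (s g) = Some one" unfolding L(1) by simp
  then obtain h' k' v' y' where hk2: "mul G k' h' = Some (s g)" "a' k' = Some y'" "a h' = Some v'" "mul Y y' v' = Some one"
    unfolding mul_Some_iff[OF aA(2,1) disjI2[OF bis]] by blast
  have hk2': "h' \<in> dom a" "k' \<in> dom a'" using hk2 by auto
  then have hkE2: "h' \<in> elems G" "k' \<in> elems G" using el by blast+
  have "s h' = s g" using mul_s_r(3)[OF hk2(1) hkE2(2,1)] E by simp
  then have "h' = g" using bisection_s_inj[OF bis hk2'(1) g] by simp
  have "mul G (s g) (inv g) = Some k'" using mul_cancel_right[OF hk2(1) hkE2(2,1)] \<open>h' = g\<close> by simp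
  then have k': "k' = inv g" using mul_unit_left[OF s_gunits[OF E] inv_closed[OF E]] by simp
  have "v = x" "v' = x" "y' = y" using hk hk2 x \<open>h = g\<close> \<open>h' = g\<close> k k' by simp_all
  then have "inverse_of Y x y"
    unfolding inverse_of_def using hk(4) hk2(4) A_values[OF aA(1) x] A_values[OF aA(2) hk(3)] by simp
  then show "\<exists>x y. a g = Some x \<and> a' (inv g) = Some y \<and> inverse_of Y x y"
    using x hk(3) k by blast
  show "s g \<in> dom (a' \<cdot> a)" unfolding L(1) using sL by simp
qed

text \<open>The sources of \<open>dom a\<close> form the support of the idempotent \<open>a'a\<close>, which is compact.\<close>

lemma dual_dom:
  assumes a: "dual a a'"
  shows "dom a \<in> cobs" "dom a' = set_inv G (dom a)"
proof -
  note aA = dualD(1,2)[OF a]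
  note bis = dual_bisection[OF a]
  have el: "x \<in> elems G" if "x \<in> dom a \<or> x \<in> dom a'" for x
    using that A_elems[OF aA(1)] A_elems[OF aA(2)] by blast
  obtain L where L: "a' \<cdot> a = chi L" "L \<in> cobs" using dual_chi[OF dual_pair_sym[OF a]] by metis
  have "s ` dom a = L"
  proof (intro equalityI subsetI)
    fix u assume "u \<in> s ` dom a"
    then obtain g where "g \<in> dom a" "u = s g" by blast
    then show "u \<in> L" using dual_values(2)[OF a] unfolding L(1) by simp
  next
    fix u assume u: "u \<in> L"
    then have "(a' \<cdot> a) u = Some one" unfolding L(1) by simp
    then obtain h k x y where hk: "mul G h k = Some u" "a' h = Some x" "a k = Some y"
      unfolding mul_Some_iff[OF aA(2,1) disjI2[OF bis]] by blast
    then have hk': "h \<in> dom a'" "k \<in> dom a" by auto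
    then have "s u = s k" using mul_s_r(3)[OF hk(1)] el by blast
    moreover have "u \<in> gunits G"
      using Z_subset[OF dualD(4)[OF a]] D_dom u unfolding L(1) by fastforce
    ultimately show "u \<in> s ` dom a" using hk'(2) gunits_s by force
  qed
  then have "compactin (gtop G) (s ` dom a)" using cobsD(3)[OF L(2)] by simp
  then show "dom a \<in> cobs"
    using compact_bisection_if_source_compact[OF bis A_open[OF aA(1)]] by blast
  show "dom a' = set_inv G (dom a)"
  proof (intro equalityI subsetI)
    fix k assume k: "k \<in> dom a'"
    then have "inv k \<in> dom a" using dual_values(1)[OF dual_pair_sym[OF a] k] by blast
    then show "k \<in> set_inv G (dom a)" using inv_inv[of k] el[of k] k unfolding set_inv_def by force
  next
    fix k assume "k \<in> set_inv G (dom a)"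
    then obtain g where "g \<in> dom a" "k = inv g" unfolding set_inv_def by blast
    then show "k \<in> dom a'" using dual_values(1)[OF a] by blast
  qed
qed

text \<open>The multiplier is \<open>d = ab'\<close>. This expresses inclusion of domains by the product and \<open>D\<close> alone, so
  it passes through diagonal isomorphisms.\<close>

lemma dom_subset_iff:
  assumes a: "dual a a'" and b: "dual b b'"
  shows "dom a \<subseteq> dom b \<longleftrightarrow> (\<exists>d\<in>D. a = d \<cdot> b)"
proof
  assume "\<exists>d\<in>D. a = d \<cdot> b"
  then show "dom a \<subseteq> dom b" using D_mul_left dualD(1)[OF b] by blast
next
  assume sub: "dom a \<subseteq> dom b"
  note A = dualD(1,2)[OF a] dualD(1,2)[OF b]
  have el: "x \<in> elems G" if "x \<in> dom b" for x using that A_elems[OF A(3)] by blast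
  note bis = dual_bisection[OF b]
  let ?d = "a \<cdot> b'"
  have "k \<in> gunits G" if kz: "?d k = Some z" for k z
  proof -
    obtain g h x y where gh: "mul G g h = Some k" "a g = Some x" "b' h = Some y"
      using kz unfolding mul_Some_iff[OF A(1,4) disjI1[OF dual_bisection[OF a]]] by blast
    have g: "g \<in> dom b" using gh(2) sub by blast
    have "h \<in> set_inv G (dom b)" using gh(3) dual_dom(2)[OF b] by blast
    then obtain l where l: "l \<in> dom b" "h = inv l" unfolding set_inv_def by blast
    have "s g = s l" using mul_s_r(1)[OF gh(1)] el[OF g] el[OF l(1)] l(2) by simp
    then have "g = l" using bisection_s_inj[OF bis g l(1)] by simp
    then show ?thesis using gh(1) l(2) mul_inv_right[OF el[OF g]] r_gunits[OF el[OF g]] by simp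
  qed
  then have "dom ?d \<subseteq> gunits G" by blast
  then have d: "?d \<in> D" using closed[OF A(1,4)] unfolding subD_def by blast
  obtain L where L: "b' \<cdot> b = chi L" "chi L \<in> D" using dual_chi[OF dual_pair_sym[OF b]] by metis
  have "a = ?d \<cdot> b"
  proof (rule ext, rule option_eqI)
    fix k z
    have "?d \<cdot> b = a \<cdot> chi L" using A L(1) by (simp add: assoc)
    moreover have "s k \<in> L" if "a k = Some z"
      using dual_values(2)[OF b, of k] sub that unfolding L(1) by auto
    ultimately show "a k = Some z \<longleftrightarrow> (?d \<cdot> b) k = Some z"
      using chi_mul_right[OF L(2) A(1)] by auto
  qed
  then show "\<exists>d\<in>D. a = d \<cdot> b" using d by blast
qed

text \<open>Products of invertible values are defined, so the domain does not shrink.\<close>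

lemma dom_mul:
  assumes a: "dual a a'" and b: "dual b b'"
  shows "dom (a \<cdot> b) = set_mul G (dom a) (dom b)"
proof -
  note A = dualD(1)[OF a] dualD(1)[OF b]
  note ab_iff = mul_Some_iff[OF A disjI1[OF dual_bisection[OF a]]]
  have "\<exists>z. (a \<cdot> b) k = Some z" if g: "g \<in> dom a" and h: "h \<in> dom b" and k: "mul G g h = Some k" for g h k
  proof -
    obtain x y where x: "a g = Some x" "inverse_of Y x y" using dual_values(1)[OF a g] by blast
    obtain v where v: "b h = Some v" using h by blast
    obtain z where "mul Y x v = Some z" using mul_inverse_defined(2)[OF x(2) A_values[OF A(2) v]] by blast
    then show ?thesis unfolding ab_iff using k x v by blast
  qed
  moreover have "k \<in> set_mul G (dom a) (dom b)" if "(a \<cdot> b) k = Some z" for k z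
    using that unfolding ab_iff set_mul_def by blast
  ultimately show ?thesis unfolding set_mul_def by blast
qed

lemma cobs_basis: "compact_Hausdorff_basis (gtop G) cobs"
proof
  show "{} \<in> cobs"
    by (rule cobsI) (auto intro: bisection_units)
  show "openin (gtop G) K" "compactin (gtop G) K" "Hausdorff_space (subtopology (gtop G) K)" if "K \<in> cobs" for K
    using cobsD(2,3)[OF that] Hausdorff_bisection[OF cobsD(1)[OF that]] by simp_all
  show "\<exists>K\<in>cobs. g \<in> K \<and> K \<subseteq> U" if "openin (gtop G) U" "g \<in> U" for U g
    using cobs_nbhd[OF that] by blast
qed

end

section \<open>Reconstruction of the groupoid\<close>

text \<open>For all small bisections \<open>K\<close> around \<open>g\<close> and \<open>L\<close> around \<open>h\<close> the element \<open>\<psi>(k)\<close> factors through \<open>\<psi>[K]\<close>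
  and \<open>\<psi>[L]\<close>. Within fixed bisections the factors are determined by the range and the source of \<open>\<psi>(k)\<close>.
  So they do not change when \<open>K\<close> and \<open>L\<close> shrink, and must be \<open>\<psi>(g)\<close> and \<open>\<psi>(h)\<close>.\<close>

lemma products_transfer:
  assumes G: "ample_groupoid G" and G': "tgroupoid G'"
    and basis: "compact_Hausdorff_basis (gtop G) (ample_groupoid.cobs G)"
    and \<psi>: "\<psi> ` elems G \<subseteq> elems G'" "inj_on \<psi> (elems G)"
    and bis: "\<And>K. K \<in> ample_groupoid.cobs G \<Longrightarrow> bisection G' (\<psi> ` K)"
    and mult: "\<And>K L. K \<in> ample_groupoid.cobs G \<Longrightarrow> L \<in> ample_groupoid.cobs G \<Longrightarrow>
        \<psi> ` set_mul G K L \<subseteq> set_mul G' (\<psi> ` K) (\<psi> ` L)"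
    and gh: "g \<in> elems G" "h \<in> elems G" "mul G g h = Some k"
  shows "mul G' (\<psi> g) (\<psi> h) = Some (\<psi> k)"
proof -
  interpret G: ample_groupoid G by fact
  interpret G': tgroupoid G' by fact
  interpret B: compact_Hausdorff_basis "gtop G" G.cobs by fact
  have el: "\<psi> x \<in> elems G'" if "x \<in> elems G" for x using that \<psi>(1) by blast
  have factors: "\<exists>x\<in>K. \<exists>y\<in>L. mul G' (\<psi> x) (\<psi> y) = Some (\<psi> k)"
    if KL: "K \<in> G.cobs" "L \<in> G.cobs" "g \<in> K" "h \<in> L" for K L
  proof -
    have "k \<in> set_mul G K L" using KL(3,4) gh(3) unfolding set_mul_def by blast
    then have "\<psi> k \<in> set_mul G' (\<psi> ` K) (\<psi> ` L)" using mult[OF KL(1,2)] by blast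
    then show ?thesis unfolding set_mul_def by blast
  qed
  obtain K where K: "K \<in> G.cobs" "g \<in> K" using B.covered gh(1) G.topspace_eq by blast
  obtain L where L: "L \<in> G.cobs" "h \<in> L" using B.covered gh(2) G.topspace_eq by blast
  note KE = subsetD[OF G.cobsD(4)[OF K(1)]] and LE = subsetD[OF G.cobsD(4)[OF L(1)]]
  obtain x y where xy: "x \<in> K" "y \<in> L" "mul G' (\<psi> x) (\<psi> y) = Some (\<psi> k)"
    using factors[OF K(1) L(1) K(2) L(2)] by blast
  note m = G'.mul_s_r[OF xy(3) el[OF KE[OF xy(1)]] el[OF LE[OF xy(2)]]]
  have "g = x"
  proof (rule B.eq_if_nbhds_subset)
    show "g \<in> topspace (gtop G)" using gh(1) G.topspace_eq by simp
    fix K1 assume K1: "K1 \<in> G.cobs" "g \<in> K1"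
    obtain K2 where K2: "K2 \<in> G.cobs" "g \<in> K2" "K2 \<subseteq> K \<inter> K1" using B.refine[OF K(1) K1(1) K(2) K1(2)] by blast
    obtain x' y' where xy': "x' \<in> K2" "y' \<in> L" "mul G' (\<psi> x') (\<psi> y') = Some (\<psi> k)"
      using factors[OF K2(1) L(1) K2(2) L(2)] by blast
    have x': "x' \<in> K" "x' \<in> K1" using xy'(1) K2(3) by blast+
    have "rng G' (\<psi> x') = rng G' (\<psi> x)"
      using G'.mul_s_r(2)[OF xy'(3) el[OF KE[OF x'(1)]] el[OF LE[OF xy'(2)]]] m(2) by simp
    then have "\<psi> x' = \<psi> x" using G'.bisection_r_inj[OF bis[OF K(1)]] x'(1) xy(1) by blast
    then have "x' = x" using inj_onD[OF \<psi>(2)] KE x'(1) xy(1) by blast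
    then show "x \<in> K1" using x'(2) by simp
  qed
  moreover have "h = y"
  proof (rule B.eq_if_nbhds_subset)
    show "h \<in> topspace (gtop G)" using gh(2) G.topspace_eq by simp
    fix L1 assume L1: "L1 \<in> G.cobs" "h \<in> L1"
    obtain L2 where L2: "L2 \<in> G.cobs" "h \<in> L2" "L2 \<subseteq> L \<inter> L1" using B.refine[OF L(1) L1(1) L(2) L1(2)] by blast
    obtain x' y' where xy': "x' \<in> K" "y' \<in> L2" "mul G' (\<psi> x') (\<psi> y') = Some (\<psi> k)"
      using factors[OF K(1) L2(1) K(2) L2(2)] by blast
    have y': "y' \<in> L" "y' \<in> L1" using xy'(2) L2(3) by blast+
    have "src G' (\<psi> y') = src G' (\<psi> y)"
      using G'.mul_s_r(3)[OF xy'(3) el[OF KE[OF xy'(1)]] el[OF LE[OF y'(1)]]] m(3) by simp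
    then have "\<psi> y' = \<psi> y" using G'.bisection_s_inj[OF bis[OF L(1)]] y'(1) xy(2) by blast
    then have "y' = y" using inj_onD[OF \<psi>(2)] LE y'(1) xy(2) by blast
    then show "y \<in> L1" using y'(2) by simp
  qed
  ultimately show ?thesis using xy(3) by simp
qed

text \<open>Sending the domain of \<open>a\<close> to the domain of \<open>\<phi>(a)\<close>, for \<open>a\<close> in a dual pair, is a well defined order
  isomorphism between the compact open bisections of \<open>G\<close> and of \<open>G'\<close> that respects products. The
  groupoids, as spaces and as algebraic structures, are recovered from this ordered semigroup.\<close>

theorem diagonal_isomorphism_induces_isomorphism:
  assumes "function_system G Y A m" and "function_system G' Y' A' m'"
    and iso: "diagonally_isomorphic G A m G' A' m'"
  shows "isomorphic_etale_groupoids G G'"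
proof -
  interpret G: function_system G Y A m by fact
  interpret G': function_system G' Y' A' m' by fact
  obtain \<phi> where \<phi>: "bij_betw \<phi> A A'" "\<forall>a\<in>A. \<forall>b\<in>A. \<phi> (m a b) = m' (\<phi> a) (\<phi> b)"
    "\<phi> ` subD G A = subD G' A'"
    using iso unfolding diagonally_isomorphic_def by blast
  have \<phi>_mul: "\<phi> (m a b) = m' (\<phi> a) (\<phi> b)" if "a \<in> A" "b \<in> A" for a b
    using \<phi>(2) that by blast
  let ?\<theta> = "inv_into A \<phi>"
  have \<phi>A: "\<phi> a \<in> A'" "?\<theta> (\<phi> a) = a" if "a \<in> A" for a
    using bij_betw_apply[OF \<phi>(1) that] bij_betw_inv_into_left[OF \<phi>(1) that] by blast+
  have \<theta>: "?\<theta> a' \<in> A" "\<phi> (?\<theta> a') = a'" if "a' \<in> A'" for a'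
    using bij_betw_apply[OF bij_betw_inv_into[OF \<phi>(1)] that] bij_betw_inv_into_right[OF \<phi>(1) that] by blast+
  have \<theta>_mul: "?\<theta> (m' a b) = m (?\<theta> a) (?\<theta> b)" if "a \<in> A'" "b \<in> A'" for a b
  proof -
    have "m' a b = \<phi> (m (?\<theta> a) (?\<theta> b))" using \<phi>(2) \<theta> that by simp
    then show ?thesis using \<phi>A(2)[of "m (?\<theta> a) (?\<theta> b)"] \<theta> that by simp
  qed
  have \<theta>_D: "?\<theta> ` subD G' A' = subD G A"
    unfolding \<phi>(3)[symmetric] by (rule inv_into_image_cancel[OF bij_betw_imp_inj_on[OF \<phi>(1)] G.D_subset])
  have dual: "G'.dual (\<phi> a) (\<phi> a')" if "G.dual a a'" for a a'
    by (rule dual_pair_hom[OF G.D_subset \<phi>A(1) \<phi>_mul G.closed \<phi>(3) that])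
  have dual': "G.dual (?\<theta> a) (?\<theta> a')" if "G'.dual a a'" for a a'
    by (rule dual_pair_hom[OF G'.D_subset \<theta>(1) \<theta>_mul G'.closed \<theta>_D that])

  \<comment> \<open>Inclusion of domains is divisibility by elements of \<open>D\<close>, which \<open>\<phi>\<close> preserves.\<close>
  have mono: "dom (\<phi> a) \<subseteq> dom (\<phi> b) \<longleftrightarrow> dom a \<subseteq> dom b" if a: "G.dual a a'" and b: "G.dual b b'" for a a' b b'
  proof -
    have A: "a \<in> A" "b \<in> A" using G.dualD(1) a b by blast+
    have "(\<exists>d\<in>subD G A. a = m d b) \<longleftrightarrow> (\<exists>d\<in>subD G' A'. \<phi> a = m' d (\<phi> b))"
    proof
      assume "\<exists>d\<in>subD G A. a = m d b"
      then obtain d where d: "d \<in> subD G A" "a = m d b" by blast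
      then have "\<phi> a = m' (\<phi> d) (\<phi> b)" using \<phi>_mul[OF G.D_closed[OF d(1)] A(2)] d(2) by (simp only:)
      then show "\<exists>d\<in>subD G' A'. \<phi> a = m' d (\<phi> b)" using d(1) \<phi>(3) by blast
    next
      assume "\<exists>d\<in>subD G' A'. \<phi> a = m' d (\<phi> b)"
      then obtain d' where d': "d' \<in> subD G' A'" "\<phi> a = m' d' (\<phi> b)" by blast
      then obtain d where d: "d \<in> subD G A" "d' = \<phi> d" unfolding \<phi>(3)[symmetric] by (elim imageE)
      have dA: "d \<in> A" using G.D_closed[OF d(1)] .
      have "\<phi> a = \<phi> (m d b)" unfolding \<phi>_mul[OF dA A(2)] d'(2) d(2) ..
      then have "a = m d b" by (rule inj_onD[OF bij_betw_imp_inj_on[OF \<phi>(1)] _ A(1) G.closed[OF dA A(2)]])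
      then show "\<exists>d\<in>subD G A. a = m d b" using d(1) by blast
    qed
    then show ?thesis using G.dom_subset_iff[OF a b] G'.dom_subset_iff[OF dual[OF a] dual[OF b]] by simp
  qed
  have "\<forall>K\<in>G.cobs. \<exists>a. (\<exists>a'. G.dual a a') \<and> dom a = K" using G.exists_dual by blast
  \<comment> \<open>\<open>\<alpha>\<close> picks a function on each compact open bisection; by monotonicity the choice does not matter.\<close>
  from bchoice[OF this] obtain \<alpha> where \<alpha>: "\<forall>K\<in>G.cobs. (\<exists>a'. G.dual (\<alpha> K) a') \<and> dom (\<alpha> K) = K"
    by blast
  define \<Phi> where "\<Phi> K = dom (\<phi> (\<alpha> K))" for K
  have \<Phi>_dom: "\<Phi> (dom a) = dom (\<phi> a)" if a: "G.dual a a'" for a a'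
  proof -
    obtain b' where b: "G.dual (\<alpha> (dom a)) b'" "dom (\<alpha> (dom a)) = dom a"
      using bspec[OF \<alpha> G.dual_dom(1)[OF a]] by (elim conjE exE)
    then have "dom (\<phi> (\<alpha> (dom a))) \<subseteq> dom (\<phi> a)" "dom (\<phi> a) \<subseteq> dom (\<phi> (\<alpha> (dom a)))"
      using mono[OF a b(1)] mono[OF b(1) a] by (simp_all only: subset_refl)
    then show ?thesis unfolding \<Phi>_def by (rule subset_antisym)
  qed
  have \<Phi>_mono: "\<Phi> K \<subseteq> \<Phi> L \<longleftrightarrow> K \<subseteq> L" if K: "K \<in> G.cobs" and L: "L \<in> G.cobs" for K L
  proof -
    obtain a' where a: "G.dual (\<alpha> K) a'" "dom (\<alpha> K) = K" using bspec[OF \<alpha> K] by (elim conjE exE)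
    obtain b' where b: "G.dual (\<alpha> L) b'" "dom (\<alpha> L) = L" using bspec[OF \<alpha> L] by (elim conjE exE)
    show ?thesis unfolding \<Phi>_def using mono[OF a(1) b(1)] a(2) b(2) by (simp only:)
  qed
  have \<Phi>_bij: "bij_betw \<Phi> G.cobs G'.cobs"
    unfolding bij_betw_def
  proof (intro conjI equalityI subsetI)
    show "inj_on \<Phi> G.cobs"
    proof (rule inj_onI)
      fix K L assume "K \<in> G.cobs" "L \<in> G.cobs" "\<Phi> K = \<Phi> L"
      then show "K = L" using \<Phi>_mono[of K L] \<Phi>_mono[of L K] by simp
    qed
    fix K'
    show "K' \<in> G'.cobs" if K': "K' \<in> \<Phi> ` G.cobs"
    proof -
      obtain K where K: "K \<in> G.cobs" "K' = \<Phi> K" using K' by blast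
      obtain a' where a: "G.dual (\<alpha> K) a'" using bspec[OF \<alpha> K(1)] by (elim conjE exE)
      show ?thesis unfolding K(2) \<Phi>_def by (rule G'.dual_dom(1)[OF dual[OF a]])
    qed
    assume "K' \<in> G'.cobs"
    from G'.exists_dual[OF this] obtain b b' where b: "G'.dual b b'" "dom b = K'" by (elim exE conjE)
    have "\<Phi> (dom (?\<theta> b)) = dom (\<phi> (?\<theta> b))" by (rule \<Phi>_dom[OF dual'[OF b(1)]])
    then have "\<Phi> (dom (?\<theta> b)) = K'" using \<theta>(2)[OF G'.dualD(1)[OF b(1)]] b(2) by simp
    then show "K' \<in> \<Phi> ` G.cobs" using G.dual_dom(1)[OF dual'[OF b(1)]] by blast
  qed
  obtain \<psi> where \<psi>: "homeomorphic_map (gtop G) (gtop G') \<psi>" "\<forall>K\<in>G.cobs. \<psi> ` K = \<Phi> K"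
    using order_iso_of_bases_homeomorphism[OF G.cobs_basis G'.cobs_basis \<Phi>_bij \<Phi>_mono] by blast
  have \<psi>_bij: "bij_betw \<psi> (elems G) (elems G')"
    using \<psi>(1) unfolding homeomorphic_eq_everything_map bij_betw_def G.topspace_eq G'.topspace_eq by blast
  then have \<psi>_inj: "inj_on \<psi> (elems G)" and \<psi>_img: "\<psi> ` elems G = elems G'" unfolding bij_betw_def by blast+
  let ?\<chi> = "inv_into (elems G) \<psi>"
  have \<chi>_bij: "bij_betw ?\<chi> (elems G') (elems G)" using bij_betw_inv_into[OF \<psi>_bij] .
  then have \<chi>_inj: "inj_on ?\<chi> (elems G')" and \<chi>_img: "?\<chi> ` elems G' = elems G" unfolding bij_betw_def by blast+
  have \<chi>\<psi>: "?\<chi> ` \<psi> ` K = K" if "K \<subseteq> elems G" for K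
    using inv_into_image_cancel[OF \<psi>_inj that] .
  have \<psi>_cobs: "\<psi> ` K \<in> G'.cobs" if "K \<in> G.cobs" for K
    using \<psi>(2) that bij_betw_apply[OF \<Phi>_bij] by simp
  have cobs'_ex: "\<exists>K\<in>G.cobs. K' = \<psi> ` K" if "K' \<in> G'.cobs" for K'
  proof -
    have "K' \<in> \<Phi> ` G.cobs" using that unfolding bij_betw_imp_surj_on[OF \<Phi>_bij] .
    then obtain K where K: "K \<in> G.cobs" "K' = \<Phi> K" by (elim imageE)
    show ?thesis
      using bspec[OF \<psi>(2) K(1)] K(2) by (intro bexI[OF _ K(1)]) simp
  qed
  have \<psi>_mult: "\<psi> ` set_mul G K L = set_mul G' (\<psi> ` K) (\<psi> ` L)" if K: "K \<in> G.cobs" and L: "L \<in> G.cobs" for K L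
  proof -
    obtain a a' where a: "G.dual a a'" "dom a = K" using G.exists_dual[OF K] by (elim exE conjE)
    obtain b b' where b: "G.dual b b'" "dom b = L" using G.exists_dual[OF L] by (elim exE conjE)
    note ab = G.dual_mul[OF a(1) b(1)]
    have "\<psi> ` set_mul G K L = \<psi> ` dom (m a b)" using G.dom_mul[OF a(1) b(1)] a(2) b(2) by simp
    also have "\<dots> = dom (\<phi> (m a b))" using \<psi>(2) G.dual_dom(1)[OF ab] \<Phi>_dom[OF ab] by simp
    also have "\<dots> = dom (m' (\<phi> a) (\<phi> b))" using \<phi>(2) G.dualD(1)[OF a(1)] G.dualD(1)[OF b(1)] by simp
    also have "\<dots> = set_mul G' (dom (\<phi> a)) (dom (\<phi> b))" by (rule G'.dom_mul[OF dual[OF a(1)] dual[OF b(1)]])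
    also have "\<dots> = set_mul G' (\<psi> ` K) (\<psi> ` L)" using \<psi>(2) K L \<Phi>_dom[OF a(1)] \<Phi>_dom[OF b(1)] a(2) b(2) by simp
    finally show ?thesis .
  qed
  have forward: "mul G' (\<psi> g) (\<psi> h) = Some (\<psi> k)" if "g \<in> elems G" "h \<in> elems G" "mul G g h = Some k" for g h k
  proof (rule products_transfer[OF G.ample_groupoid_axioms G'.tgroupoid_axioms G.cobs_basis _ \<psi>_inj _ _ that])
    show "\<psi> ` elems G \<subseteq> elems G'" using \<psi>_img by simp
    show "bisection G' (\<psi> ` K)" if "K \<in> G.cobs" for K using G'.cobsD(1)[OF \<psi>_cobs[OF that]] .
    show "\<psi> ` set_mul G K L \<subseteq> set_mul G' (\<psi> ` K) (\<psi> ` L)" if "K \<in> G.cobs" "L \<in> G.cobs" for K L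
      using \<psi>_mult[OF that] by simp
  qed
  have backward: "mul G (?\<chi> g) (?\<chi> h) = Some (?\<chi> k)" if "g \<in> elems G'" "h \<in> elems G'" "mul G' g h = Some k" for g h k
  proof (rule products_transfer[OF G'.ample_groupoid_axioms G.tgroupoid_axioms G'.cobs_basis _ \<chi>_inj _ _ that])
    show "?\<chi> ` elems G' \<subseteq> elems G" using \<chi>_img by simp
    show "bisection G (?\<chi> ` K')" if K': "K' \<in> G'.cobs" for K'
    proof -
      obtain K where K: "K \<in> G.cobs" "K' = \<psi> ` K" using cobs'_ex[OF K'] by blast
      then show ?thesis using \<chi>\<psi>[OF G.cobsD(4)[OF K(1)]] G.cobsD(1)[OF K(1)] by simp
    qed
    show "?\<chi> ` set_mul G' K' L' \<subseteq> set_mul G (?\<chi> ` K') (?\<chi> ` L')" if KL: "K' \<in> G'.cobs" "L' \<in> G'.cobs" for K' L'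
    proof -
      obtain K where K: "K \<in> G.cobs" "K' = \<psi> ` K" using cobs'_ex[OF KL(1)] by blast
      obtain L where L: "L \<in> G.cobs" "L' = \<psi> ` L" using cobs'_ex[OF KL(2)] by blast
      have "set_mul G' K' L' = \<psi> ` set_mul G K L" using \<psi>_mult[OF K(1) L(1)] K(2) L(2) by simp
      moreover have "set_mul G K L \<subseteq> elems G"
        using G.bisection_subset[OF G.bisection_set_mul[OF G.cobsD(1)[OF K(1)] G.cobsD(1)[OF L(1)]]] .
      ultimately show ?thesis
        using \<chi>\<psi> G.cobsD(4)[OF K(1)] G.cobsD(4)[OF L(1)] K(2) L(2) by simp
    qed
  qed
  have hom: "mul G' (\<psi> g) (\<psi> h) = map_option \<psi> (mul G g h)" if gh: "g \<in> elems G" "h \<in> elems G" for g h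
  proof (cases "mul G g h")
    case (Some k)
    then show ?thesis using forward[OF gh Some] by simp
  next
    case None
    have "mul G' (\<psi> g) (\<psi> h) = None"
    proof (rule ccontr)
      assume "mul G' (\<psi> g) (\<psi> h) \<noteq> None"
      then obtain k where "mul G' (\<psi> g) (\<psi> h) = Some k" by blast
      moreover have "\<psi> g \<in> elems G'" "\<psi> h \<in> elems G'" using gh \<psi>_img by blast+
      ultimately have "mul G (?\<chi> (\<psi> g)) (?\<chi> (\<psi> h)) = Some (?\<chi> k)" by (rule backward[rotated 2])
      then show False using None gh inv_into_f_f[OF \<psi>_inj] by simp
    qed
    then show ?thesis using None by simp
  qed
  show ?thesis
    unfolding isomorphic_etale_groupoids_def
    using G.etale G'.etale \<psi>_bij hom \<psi>(1) by blast
qed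

theorem corollary8p5:
  fixes G :: "'g top_groupoid" and G' :: "'h top_groupoid"
    and Y :: "'y semigroupoid" and Y' :: "'z semigroupoid"
    and A :: "('g \<rightharpoonup> 'y) set" and A' :: "('h \<rightharpoonup> 'z) set"
    and m :: "('g \<rightharpoonup> 'y) \<Rightarrow> ('g \<rightharpoonup> 'y) \<Rightarrow> ('g \<rightharpoonup> 'y)"
    and m' :: "('h \<rightharpoonup> 'z) \<Rightarrow> ('h \<rightharpoonup> 'z) \<Rightarrow> ('h \<rightharpoonup> 'z)"
  assumes "topologised_groupoid G" and "topologised_groupoid G'"
    and "Hausdorff_space (subtopology (gtop G) (gunits G))"
    and "Hausdorff_space (subtopology (gtop G') (gunits G'))"
    and "indecomposable Y" and "indecomposable Y'"
    and "function_semigroup G Y A m" and "function_semigroup G' Y' A' m'"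
    and "\<forall>a\<in>subN G A. \<forall>b\<in>subN G A. dom (m a b) \<subseteq> set_mul G (dom a) (dom b)"
    and "\<forall>a\<in>subN G' A'. \<forall>b\<in>subN G' A'. dom (m' a b) \<subseteq> set_mul G' (dom a) (dom b)"
    and "exhaustive G Y (subD G A)" and "exhaustive G' Y' (subD G' A')"
    and "compact_bumpy G Y (subS G A)" and "compact_bumpy G' Y' (subS G' A')"
    and "ample G" and "ample G'"
    and "subCRZ G Y A m \<subseteq> subS G A" and "subCRZ G' Y' A' m' \<subseteq> subS G' A'"
    and "diagonally_isomorphic G A m G' A' m'"
  shows "isomorphic_etale_groupoids G G'"
proof (rule diagonal_isomorphism_induces_isomorphism)
  show "function_system G Y A m" by unfold_locales fact+
  show "function_system G' Y' A' m'" by unfold_locales fact+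
qed fact

end
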